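(* Let $1 \le p < \infty$, let $\Omega$ be a bounded symmetric domain in $\mathbf{C}^n$ (in its standard representation), and let $\lambda < \varepsilon_\Omega$. Let $\varphi:\Omega\to\mathbf{C}^n$ be holomorphic with $\varphi(\Omega)\subseteq\Omega$ and let $\psi \in A^p_\lambda(\Omega, dV_\lambda)$. Then the weighted composition operator $W_{\varphi,\psi}$ is compact on $A^p_\lambda(\Omega, dV_\lambda)$ if and only if the measure $\mu_{\varphi,\psi,p}$ is a vanishing Carleson measure on $A^p_\lambda(\Omega, dV_\lambda)$.
   Context: $\Omega$ is a bounded symmetric domain in $\mathbf{C}^n$ in its standard (Harish-Chandra, i.e. circular and centred at $0$) representation, with volume measure $dV$ normalized so that $V(\Omega)=1$; $K(z,\omega)$ is its Bergman kernel with respect to $dV$, so that $K(z,0)=K(0,\omega)=1$ for all $z,\omega\in\Omega$. $K(z,\omega)\neq 0$ for all $z,\omega\in\Omega$. $\varepsilon_\Omega>0$ is a number such that $C_\lambda=\int_\Omega K(z,z)^\lambda\,dV(z)<\infty$ for every real $\lambda<\varepsilon_\Omega$. For such $\lambda$, $dV_\lambda(z)=C_\lambda^{-1}K(z,z)^\lambda\,dV(z)$ is a probability measure. $A^p_\lambda(\Omega,dV_\lambda)$ is the weighted Bergman space of holomorphic functions $f$ on $\Omega$ with $\|f\|_{A^p_\lambda}=\left(\int_\Omega|f|^p\,dV_\lambda\right)^{1/p}<\infty$. The weighted composition operator is $W_{\varphi,\psi}f(z)=\psi(z)f(\varphi(z))$, $z\in\Omega$, for $f$ holomorphic on $\Omega$.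 The measure $\mu_{\varphi,\psi,p}$ is defined by $\mu_{\varphi,\psi,p}(E)=\int_{\varphi^{-1}(E)}|\psi|^p\,dV_\lambda$ for measurable $E\subseteq\Omega$. A finite positive Borel measure $\mu$ on $\Omega$ is a vanishing Carleson measure on $A^p_\lambda(\Omega,dV_\lambda)$ if it satisfies one of the following conditions, which are known to be equivalent: (1) the inclusion map $A^p_\lambda(\Omega,dV_\lambda)\to L^p(\Omega,d\mu)$ is compact; (2) the Berezin transform $\tilde\mu_\lambda(z)=\int_\Omega|k_z(\omega)|^{2(1-\lambda)}\,d\mu(\omega)$ tends to $0$ as $z\to\partial\Omega$ (topological boundary), where $k_z(\omega)=K(\omega,z)/\sqrt{K(z,z)}$; (3) for some (equivalently, all) $r>0$, $\mu(E(z,r))/|E(z,r)|^{1-\lambda}\to0$ as $z\to\partial\Omega$, where $E(z,r)=\{\omega\in\Omega:\beta(z,\omega)<r\}$, $\beta$ is the Bergman distance and $|E(z,r)|=V(E(z,r))$. *)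

theory Defs
  imports "HOL-Analysis.Analysis"
begin

section \<open>Holomorphic functions of several variables\<close>

text \<open>The sets are meant to be open: the derivative is taken in the full space.\<close>

definition holomorphic_fun_on :: "(complex^'n \<Rightarrow> complex) \<Rightarrow> (complex^'n) set \<Rightarrow> bool" where
  "holomorphic_fun_on f \<Omega> \<longleftrightarrow>
     (\<forall>z\<in>\<Omega>. \<exists>L. (f has_derivative L) (at z) \<and> (\<forall>c v. L (c *s v) = c * L v))"

definition holomorphic_map_on ::
    "(complex^'n \<Rightarrow> complex^'m) \<Rightarrow> (complex^'n) set \<Rightarrow> bool" where
  "holomorphic_map_on \<phi> \<Omega> \<longleftrightarrow> (\<forall>i. holomorphic_fun_on (\<lambda>z. \<phi> z $ i) \<Omega>)"

section \<open>Bounded symmetric domains in their standard representation\<close>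

definition bounded_symmetric_domain :: "(complex^'n) set \<Rightarrow> bool" where
  "bounded_symmetric_domain \<Omega> \<longleftrightarrow>
     open \<Omega> \<and> connected \<Omega> \<and> bounded \<Omega> \<and> \<Omega> \<noteq> {} \<and>
     (\<forall>a\<in>\<Omega>. \<exists>s. holomorphic_map_on s \<Omega> \<and> s ` \<Omega> \<subseteq> \<Omega> \<and> (\<forall>z\<in>\<Omega>. s (s z) = z) \<and>
        s a = a \<and> (\<exists>e>0. \<forall>z\<in>\<Omega>. dist z a < e \<and> s z = z \<longrightarrow> z = a))"

text \<open>
  By Cartan's theorem on circular domains, a bounded symmetric domain which is circular and
  contains the origin is, up to a linear change of coordinates, its Harish-Chandra realization.
\<close>

definition standard_bounded_symmetric_domain :: "(complex^'n) set \<Rightarrow> bool" where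
  "standard_bounded_symmetric_domain \<Omega> \<longleftrightarrow>
     bounded_symmetric_domain \<Omega> \<and> 0 \<in> \<Omega> \<and> (\<forall>z\<in>\<Omega>. \<forall>c. cmod c = 1 \<longrightarrow> c *s z \<in> \<Omega>)"

definition normalized_volume :: "(complex^'n) set \<Rightarrow> (complex^'n) measure" where
  "normalized_volume \<Omega> = uniform_measure (restrict_space lborel \<Omega>) \<Omega>"

section \<open>Function spaces\<close>

text \<open>
  Elements of \<open>L\<^sup>p\<close> are represented by functions rather than by classes, so that \<open>Lp_norm\<close> is only
  a seminorm. Values outside the space of the measure (below, outside \<open>\<Omega>\<close>) play no role.
\<close>

definition Lp_space :: "real \<Rightarrow> 'a measure \<Rightarrow> ('a \<Rightarrow> complex) set" where
  "Lp_space p M = {f \<in> borel_measurable M. integrable M (\<lambda>x. cmod (f x) powr p)}"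

definition Lp_norm :: "real \<Rightarrow> 'a measure \<Rightarrow> ('a \<Rightarrow> complex) \<Rightarrow> real" where
  "Lp_norm p M f = (\<integral>x. cmod (f x) powr p \<partial>M) powr (1 / p)"

definition bergman_space ::
    "(complex^'n) set \<Rightarrow> real \<Rightarrow> (complex^'n) measure \<Rightarrow> (complex^'n \<Rightarrow> complex) set" where
  "bergman_space \<Omega> p M = {f \<in> Lp_space p M. holomorphic_fun_on f \<Omega>}"

text \<open>
  Compactness of a linear map \<open>T\<close> from \<open>(X, N)\<close> to \<open>(Y, N')\<close>; that \<open>T\<close> takes values in \<open>Y\<close> is part
  of the notion.
\<close>

definition compact_linear_map ::
    "('a \<Rightarrow> complex) set \<Rightarrow> (('a \<Rightarrow> complex) \<Rightarrow> real) \<Rightarrow>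
     ('b \<Rightarrow> complex) set \<Rightarrow> (('b \<Rightarrow> complex) \<Rightarrow> real) \<Rightarrow>
     (('a \<Rightarrow> complex) \<Rightarrow> ('b \<Rightarrow> complex)) \<Rightarrow> bool" where
  "compact_linear_map X N Y N' T \<longleftrightarrow>
     (\<forall>f\<in>X. \<forall>g\<in>X. \<forall>a b. T (\<lambda>x. a * f x + b * g x) = (\<lambda>y. a * T f y + b * T g y)) \<and>
     T ` X \<subseteq> Y \<and>
     (\<forall>f B. (\<forall>k. f k \<in> X \<and> N (f k) \<le> B) \<longrightarrow>
        (\<exists>g\<in>Y. \<exists>r::nat \<Rightarrow> nat. strict_mono r \<and>
           (\<lambda>k. N' (\<lambda>y. T (f (r k)) y - g y)) \<longlonglongrightarrow> 0))"

section \<open>The Bergman kernel and the weighted measures\<close>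

definition is_bergman_kernel ::
    "(complex^'n) set \<Rightarrow> (complex^'n \<Rightarrow> complex^'n \<Rightarrow> complex) \<Rightarrow> bool" where
  "is_bergman_kernel \<Omega> K \<longleftrightarrow>
     (\<forall>w\<in>\<Omega>. (\<lambda>z. K z w) \<in> bergman_space \<Omega> 2 (normalized_volume \<Omega>) \<and>
        (\<forall>f\<in>bergman_space \<Omega> 2 (normalized_volume \<Omega>).
           f w = (\<integral>z. f z * cnj (K z w) \<partial>normalized_volume \<Omega>)))"

text \<open>A reproducing kernel is unique on \<open>\<Omega> \<times> \<Omega>\<close>; only its values there are used.\<close>

definition bergman_kernel :: "(complex^'n) set \<Rightarrow> complex^'n \<Rightarrow> complex^'n \<Rightarrow> complex" where
  "bergman_kernel \<Omega> = (SOME K. is_bergman_kernel \<Omega> K)"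

text \<open>\<open>K(z,z)\<close> is real, since it equals the squared norm of \<open>K(\<cdot>,z)\<close>.\<close>

definition kernel_weight :: "(complex^'n) set \<Rightarrow> real \<Rightarrow> complex^'n \<Rightarrow> real" where
  "kernel_weight \<Omega> lam z = Re (bergman_kernel \<Omega> z z) powr lam"

definition weight_constant :: "(complex^'n) set \<Rightarrow> real \<Rightarrow> ennreal" where
  "weight_constant \<Omega> lam = (\<integral>\<^sup>+z. ennreal (kernel_weight \<Omega> lam z) \<partial>normalized_volume \<Omega>)"

definition weighted_volume :: "(complex^'n) set \<Rightarrow> real \<Rightarrow> (complex^'n) measure" where
  "weighted_volume \<Omega> lam =
     density (normalized_volume \<Omega>) (\<lambda>z. ennreal (kernel_weight \<Omega> lam z) / weight_constant \<Omega> lam)"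

abbreviation weighted_bergman_space ::
    "(complex^'n) set \<Rightarrow> real \<Rightarrow> real \<Rightarrow> (complex^'n \<Rightarrow> complex) set" where
  "weighted_bergman_space \<Omega> p lam \<equiv> bergman_space \<Omega> p (weighted_volume \<Omega> lam)"

section \<open>Weighted composition operators and vanishing Carleson measures\<close>

definition weighted_composition ::
    "('a \<Rightarrow> 'a) \<Rightarrow> ('a \<Rightarrow> complex) \<Rightarrow> ('a \<Rightarrow> complex) \<Rightarrow> 'a \<Rightarrow> complex" where
  "weighted_composition \<phi> \<psi> f = (\<lambda>z. \<psi> z * f (\<phi> z))"

definition pullback_measure ::
    "(complex^'n) set \<Rightarrow> real \<Rightarrow> (complex^'n \<Rightarrow> complex^'n) \<Rightarrow> (complex^'n \<Rightarrow> complex) \<Rightarrow> real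
     \<Rightarrow> (complex^'n) measure" where
  "pullback_measure \<Omega> lam \<phi> \<psi> p =
     distr (density (weighted_volume \<Omega> lam) (\<lambda>z. ennreal (cmod (\<psi> z) powr p)))
       (restrict_space borel \<Omega>) \<phi>"

lemma emeasure_pullback_measure:
  assumes "\<phi> \<in> measurable (weighted_volume \<Omega> lam) (restrict_space borel \<Omega>)"
    and "\<psi> \<in> borel_measurable (weighted_volume \<Omega> lam)"
    and "E \<in> sets (restrict_space borel \<Omega>)"
  shows "emeasure (pullback_measure \<Omega> lam \<phi> \<psi> p) E =
    (\<integral>\<^sup>+z\<in>\<phi> -` E \<inter> \<Omega>. ennreal (cmod (\<psi> z) powr p) \<partial>weighted_volume \<Omega> lam)"
proof -
  have sp: "space (weighted_volume \<Omega> lam) = \<Omega>"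
    by (simp add: weighted_volume_def normalized_volume_def uniform_measure_def space_restrict_space)
  have "\<phi> -` E \<inter> \<Omega> \<in> sets (weighted_volume \<Omega> lam)"
    using measurable_sets[OF assms(1,3)] by (simp add: sp)
  then show ?thesis
    using assms by (simp add: pullback_measure_def emeasure_distr emeasure_density sp)
qed

text \<open>
  Of the equivalent characterizations of vanishing Carleson measures, the defining one is taken to
  be compactness of the inclusion map into \<open>L\<^sup>p(\<mu>)\<close>.
\<close>

definition vanishing_carleson_measure ::
    "(complex^'n) set \<Rightarrow> real \<Rightarrow> real \<Rightarrow> (complex^'n) measure \<Rightarrow> bool" where
  "vanishing_carleson_measure \<Omega> p lam \<mu> \<longleftrightarrow>
     sets \<mu> = sets (restrict_space borel \<Omega>) \<and> finite_measure \<mu> \<and>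
     compact_linear_map (weighted_bergman_space \<Omega> p lam) (Lp_norm p (weighted_volume \<Omega> lam))
       (Lp_space p \<mu>) (Lp_norm p \<mu>) (\<lambda>f. f)"

end

theory Submission
  imports Defs "HOL-Complex_Analysis.Cauchy_Integral_Formula"
begin

text \<open>
Write \<open>M\<close> for the weighted volume, \<open>\<mu>\<close> for the pullback measure and \<open>W\<close> for the weighted composition
operator. The change of variables formula gives \<open>\<integral>|W f|\<^sup>p dM = \<integral>|f|\<^sup>p d\<mu>\<close>
(\<open>Lp_power_weighted_composition\<close>): as far as seminorms can see, \<open>W\<close> on the Bergman space and the
inclusion of the Bergman space into \<open>L\<^sup>p(\<mu>)\<close> are the same map. They differ only in their target,
and so in the limits that compactness asks for. When the target is complete, a map is compact
exactly if the image of every bounded sequence has a Cauchy subsequence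
(\<open>compact_linear_map_iff_Cauchy_subsequence\<close>), and this formulation no longer mentions limits. So
the theorem follows from the completeness of both targets.

Completeness of \<open>L\<^sup>p(\<mu>)\<close> is the Riesz--Fischer theorem (\<open>Lp_complete\<close>). On the finite measure \<open>\<mu>\<close>, an
\<open>L\<^sup>p\<close>-Cauchy sequence is \<open>L\<^sup>1\<close>-Cauchy, hence has an almost everywhere convergent subsequence, and
Fatou's lemma turns its pointwise limit into the \<open>L\<^sup>p\<close>-limit of the whole sequence.

Completeness of the Bergman space (\<open>bergman_space_complete\<close>) rests on the mean value inequality over
balls. It bounds point evaluations locally uniformly by the \<open>L\<^sup>p\<close>-seminorm, provided that near each
point \<open>M\<close> dominates a multiple of Lebesgue measure. Cauchy sequences then converge locally uniformly,
and locally uniform limits of holomorphic functions are holomorphic, since Cauchy's estimate on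
complex lines controls their derivatives.

That the weighted volume dominates Lebesgue measure locally means that the weight \<open>K(z,z)\<^sup>\<lambda>\<close> is
measurable and locally bounded away from \<open>0\<close>. The case of the unweighted measure gives completeness
of the unweighted \<open>A\<^sup>2\<close>, hence the Bergman kernel as the solution of an extremal problem
(\<open>point_evaluation_representable\<close>). Since \<open>K(z,z)\<close> is the best constant \<open>c\<close> in \<open>|f(z)|\<^sup>2 \<le> c \<parallel>f\<parallel>\<^sup>2\<close>, it
is at least \<open>1\<close>, locally bounded and lower semicontinuous.
\<close>

section \<open>Holomorphic functions of several variables\<close>

lemma holomorphic_fun_on_continuous_on:
  assumes "holomorphic_fun_on f S"
  shows "continuous_on S f"
  using assms unfolding holomorphic_fun_on_def
  by (meson continuous_at_imp_continuous_on has_derivative_continuous)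

lemma holomorphic_fun_on_const: "holomorphic_fun_on (\<lambda>z. c) S"
  unfolding holomorphic_fun_on_def
  by (intro ballI exI[of _ "\<lambda>_. 0"]) auto

lemma holomorphic_fun_on_linear:
  assumes "holomorphic_fun_on f S" "holomorphic_fun_on g S"
  shows "holomorphic_fun_on (\<lambda>z. a * f z + b * g z) S"
  unfolding holomorphic_fun_on_def
proof
  fix z assume "z \<in> S"
  then obtain L L' where *: "(f has_derivative L) (at z)" "\<And>c v. L (c *s v) = c * L v"
      "(g has_derivative L') (at z)" "\<And>c v. L' (c *s v) = c * L' v"
    using assms unfolding holomorphic_fun_on_def by metis
  then show "\<exists>L. ((\<lambda>z. a * f z + b * g z) has_derivative L) (at z) \<and> (\<forall>c v. L (c *s v) = c * L v)"
    by (intro exI[of _ "\<lambda>h. a * L h + b * L' h"])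
      (auto intro!: derivative_eq_intros simp: algebra_simps)
qed

lemma holomorphic_fun_on_diff:
  assumes "holomorphic_fun_on f S" "holomorphic_fun_on g S"
  shows "holomorphic_fun_on (\<lambda>z. f z - g z) S"
  using holomorphic_fun_on_linear[OF assms, of 1 "-1"] by simp

lemma holomorphic_fun_on_mult:
  assumes "holomorphic_fun_on f S" "holomorphic_fun_on g S"
  shows "holomorphic_fun_on (\<lambda>z. f z * g z) S"
  unfolding holomorphic_fun_on_def
proof
  fix z assume "z \<in> S"
  then obtain L L' where *: "(f has_derivative L) (at z)" "\<And>c v. L (c *s v) = c * L v"
      "(g has_derivative L') (at z)" "\<And>c v. L' (c *s v) = c * L' v"
    using assms unfolding holomorphic_fun_on_def by metis
  then show "\<exists>L. ((\<lambda>z. f z * g z) has_derivative L) (at z) \<and> (\<forall>c v. L (c *s v) = c * L v)"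
    by (intro exI[of _ "\<lambda>h. f z * L' h + L h * g z"])
      (auto intro!: derivative_eq_intros simp: algebra_simps)
qed

lemma has_derivative_vec_componentwise:
  fixes \<phi> :: "'a::real_normed_vector \<Rightarrow> complex^'m"
  assumes "\<And>i. ((\<lambda>z. \<phi> z $ i) has_derivative L i) (at z)"
  shows "(\<phi> has_derivative (\<lambda>h. \<chi> i. L i h)) (at z)"
proof (subst has_derivative_componentwise_within, intro ballI)
  fix b :: "complex^'m" assume "b \<in> Basis"
  then obtain i u where b: "b = axis i u" "u \<in> Basis"
    by (auto simp: Basis_vec_def)
  show "((\<lambda>x. \<phi> x \<bullet> b) has_derivative (\<lambda>x. (\<chi> i. L i x) \<bullet> b)) (at z)"
    using has_derivative_inner_left[OF assms[of i], of u] by (simp add: b inner_axis)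
qed

lemma holomorphic_fun_on_compose:
  assumes f: "holomorphic_fun_on f T" and \<phi>: "holomorphic_map_on \<phi> S" and "\<phi> ` S \<subseteq> T"
  shows "holomorphic_fun_on (\<lambda>z. f (\<phi> z)) S"
  unfolding holomorphic_fun_on_def
proof
  fix z assume z: "z \<in> S"
  then have "\<forall>i. \<exists>L. ((\<lambda>z. \<phi> z $ i) has_derivative L) (at z) \<and> (\<forall>c v. L (c *s v) = c * L v)"
    using \<phi> unfolding holomorphic_map_on_def holomorphic_fun_on_def by blast
  then obtain L where L: "\<And>i. ((\<lambda>z. \<phi> z $ i) has_derivative L i) (at z)"
      "\<And>i c v. L i (c *s v) = c * L i v"
    by metis
  obtain L' where L': "(f has_derivative L') (at (\<phi> z))" "\<And>c v. L' (c *s v) = c * L' v"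
    using f z assms(3) unfolding holomorphic_fun_on_def by blast
  have "((\<lambda>z. f (\<phi> z)) has_derivative (\<lambda>h. L' (\<chi> i. L i h))) (at z)"
    using has_derivative_compose[OF has_derivative_vec_componentwise[OF L(1)] L'(1)] .
  moreover have "L' (\<chi> i. L i (c *s v)) = c * L' (\<chi> i. L i v)" for c v
  proof -
    have "(\<chi> i. L i (c *s v)) = c *s (\<chi> i. L i v)"
      by (simp add: vec_eq_iff L(2))
    then show ?thesis by (simp add: L'(2))
  qed
  ultimately show "\<exists>L. ((\<lambda>z. f (\<phi> z)) has_derivative L) (at z) \<and> (\<forall>c v. L (c *s v) = c * L v)"
    by blast
qed

lemma holomorphic_map_on_continuous_on:
  assumes "holomorphic_map_on \<phi> S"
  shows "continuous_on S \<phi>"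
proof -
  have "continuous_on S (\<lambda>z. \<chi> i. \<phi> z $ i)"
    using assms unfolding holomorphic_map_on_def
    by (intro continuous_on_vec_lambda holomorphic_fun_on_continuous_on) blast
  then show ?thesis by simp
qed

lemma norm_complex_scale: "norm (c *s v) = cmod c * norm (v :: complex^'n)"
  by (simp add: norm_vec_def norm_mult L2_set_right_distrib)

lemma bounded_linear_complex_line: "bounded_linear (\<lambda>\<zeta>::complex. \<zeta> *s (v::complex^'n))"
proof
  show "\<exists>K. \<forall>x. norm (x *s v) \<le> norm x * K"
    by (auto simp: norm_complex_scale)
qed (simp_all add: vec_eq_iff algebra_simps)

lemma has_field_derivative_slice:
  fixes v :: "complex^'n"
  assumes "(f has_derivative L) (at (z + \<zeta> *s v))" "\<And>c v. L (c *s v) = c * L v"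
  shows "((\<lambda>\<zeta>. f (z + \<zeta> *s v)) has_field_derivative L v) (at \<zeta>)"
proof -
  have "((\<lambda>\<zeta>. z + \<zeta> *s v) has_derivative (\<lambda>\<zeta>. \<zeta> *s v)) (at \<zeta>)"
    using has_derivative_add[OF has_derivative_const bounded_linear_imp_has_derivative[OF bounded_linear_complex_line]]
    by simp
  from has_derivative_compose[OF this assms(1)] show ?thesis
    by (simp add: has_field_derivative_def assms(2) mult_commute_abs)
qed

lemma holomorphic_on_slice:
  fixes v :: "complex^'n"
  assumes "holomorphic_fun_on f S" "\<And>\<zeta>. \<zeta> \<in> A \<Longrightarrow> z + \<zeta> *s v \<in> S"
  shows "(\<lambda>\<zeta>. f (z + \<zeta> *s v)) holomorphic_on A"
  unfolding holomorphic_on_def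
proof
  fix \<zeta> assume "\<zeta> \<in> A"
  then obtain L where "(f has_derivative L) (at (z + \<zeta> *s v))" "\<And>c v. L (c *s v) = c * L v"
    using assms unfolding holomorphic_fun_on_def by blast
  from has_field_derivative_slice[OF this]
  show "(\<lambda>\<zeta>. f (z + \<zeta> *s v)) field_differentiable at \<zeta> within A"
    using field_differentiable_at_within field_differentiable_def by blast
qed

text \<open>
The derivative in the direction \<open>h\<close> is the derivative at \<open>0\<close> of the slice \<open>\<zeta> \<mapsto> f (z + \<zeta> h)\<close>, which is
holomorphic on the disc of radius \<open>r / \<parallel>h\<parallel>\<close>; so this is Cauchy's inequality in one variable.
\<close>

lemma Cauchy_derivative_bound:
  fixes z :: "complex^'n"
  assumes f: "holomorphic_fun_on f S" and sub: "cball z r \<subseteq> S" and r: "r > 0"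
    and B: "\<And>x. x \<in> cball z r \<Longrightarrow> cmod (f x) \<le> B"
    and L: "(f has_derivative L) (at z)" "\<And>c v. L (c *s v) = c * L v"
  shows "cmod (L h) \<le> B / r * norm h"
proof (cases "h = 0")
  case True
  have "L 0 = 0" using L(2)[of 0 0] by simp
  then show ?thesis using True by simp
next
  case False
  define R where "R = r / norm h"
  have R: "R > 0" using False r by (simp add: R_def)
  have in_ball: "z + \<zeta> *s h \<in> cball z r" if "cmod \<zeta> \<le> R" for \<zeta>
    using that False by (simp add: dist_norm norm_complex_scale R_def field_simps)
  define g where "g = (\<lambda>\<zeta>. f (z + \<zeta> *s h))"
  have hol: "g holomorphic_on cball 0 R"
    unfolding g_def using in_ball sub by (intro holomorphic_on_slice[OF f]) auto
  have "cmod ((deriv ^^ 1) g 0) \<le> fact 1 * B / R ^ 1"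
  proof (rule Cauchy_inequality)
    show "g holomorphic_on ball 0 R"
      by (rule holomorphic_on_subset[OF hol]) auto
    show "continuous_on (cball 0 R) g"
      using hol by (rule holomorphic_on_imp_continuous_on)
  qed (use R in_ball B in \<open>auto simp: g_def\<close>)
  moreover have "(g has_field_derivative L h) (at 0)"
    unfolding g_def by (rule has_field_derivative_slice) (use L in auto)
  then have "deriv g 0 = L h" by (rule DERIV_imp_deriv)
  ultimately show ?thesis by (simp add: R_def)
qed

text \<open>
By \<open>Cauchy_derivative_bound\<close>, applied to differences, the derivatives are locally uniformly Cauchy as
linear maps, so the limit may be differentiated term by term; complex homogeneity of the derivatives
passes to the limit.
\<close>

lemma holomorphic_locally_uniform_limit:
  fixes f :: "nat \<Rightarrow> complex^'n \<Rightarrow> complex"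
  assumes hol: "\<And>k. holomorphic_fun_on (f k) S"
    and cauchy: "\<And>z0. z0 \<in> S \<Longrightarrow> \<exists>s>0. ball z0 s \<subseteq> S \<and>
      (\<forall>e>0. \<exists>N. \<forall>i\<ge>N. \<forall>j\<ge>N. \<forall>z\<in>ball z0 s. cmod (f i z - f j z) \<le> e)"
  obtains F where "holomorphic_fun_on F S" "\<And>z. z \<in> S \<Longrightarrow> (\<lambda>k. f k z) \<longlonglongrightarrow> F z"
proof
  define F where "F = (\<lambda>z. lim (\<lambda>k. f k z))"
  show lim: "(\<lambda>k. f k z) \<longlonglongrightarrow> F z" if z: "z \<in> S" for z
  proof -
    obtain s where s: "s > 0" and
      "\<And>e. e > 0 \<Longrightarrow> \<exists>N. \<forall>i\<ge>N. \<forall>j\<ge>N. \<forall>x\<in>ball z s. cmod (f i x - f j x) \<le> e"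
      using cauchy[OF z] by blast
    then have "\<exists>N. \<forall>i\<ge>N. \<forall>j\<ge>N. cmod (f i z - f j z) \<le> e" if "e > 0" for e
      using that by (meson centre_in_ball)
    then have "Cauchy (\<lambda>k. f k z)"
      unfolding Cauchy_iff by (metis field_lbound_gt_zero le_less_trans)
    then show ?thesis
      by (simp add: F_def Cauchy_convergent_iff convergent_LIMSEQ_iff)
  qed
  have "\<forall>k. \<forall>z\<in>S. \<exists>L. (f k has_derivative L) (at z) \<and> (\<forall>c v. L (c *s v) = c * L v)"
    using hol unfolding holomorphic_fun_on_def by blast
  then obtain L where L: "\<And>k z. z \<in> S \<Longrightarrow> (f k has_derivative L k z) (at z)"
      "\<And>k z c v. z \<in> S \<Longrightarrow> L k z (c *s v) = c * L k z v"
    by metis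
  show "holomorphic_fun_on F S"
    unfolding holomorphic_fun_on_def
  proof
    fix z0 assume z0: "z0 \<in> S"
    obtain s where s: "s > 0" "ball z0 s \<subseteq> S" and
      uc: "\<And>e. e > 0 \<Longrightarrow> \<exists>N. \<forall>i\<ge>N. \<forall>j\<ge>N. \<forall>z\<in>ball z0 s. cmod (f i z - f j z) \<le> e"
      using cauchy[OF z0] by blast
    define B where "B = ball z0 (s/2)"
    have sub: "cball x (s/4) \<subseteq> ball z0 s" if "x \<in> B" for x
      using that s(1) unfolding B_def
      by (auto simp: subset_iff) (smt (verit) dist_triangle field_sum_of_halves)
    have BS: "B \<subseteq> S" using s unfolding B_def by auto
    have derC: "\<exists>N. \<forall>i\<ge>N. \<forall>j\<ge>N. \<forall>x\<in>B. \<forall>h. cmod (L i x h - L j x h) \<le> e * norm h"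
      if e: "e > 0" for e
    proof -
      obtain N where N: "\<And>i j z. i \<ge> N \<Longrightarrow> j \<ge> N \<Longrightarrow> z \<in> ball z0 s \<Longrightarrow> cmod (f i z - f j z) \<le> e * (s/4)"
        using uc[OF mult_pos_pos[OF e, of "s/4"]] s(1) by (meson divide_pos_pos zero_less_numeral)
      have "cmod (L i x h - L j x h) \<le> e * norm h" if "i \<ge> N" "j \<ge> N" "x \<in> B" for i j x h
      proof -
        \<comment> \<open>Cauchy estimate on the ball of radius s/4 about x, which stays inside the ball of radius s about z0.\<close>
        have "cmod (L i x h - L j x h) \<le> (e * (s/4)) / (s/4) * norm h"
        proof (rule Cauchy_derivative_bound[where f="\<lambda>z. f i z - f j z" and S=S and z=x])
          show "holomorphic_fun_on (\<lambda>z. f i z - f j z) S"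
            by (intro holomorphic_fun_on_diff hol)
          show "cball x (s/4) \<subseteq> S" using sub that s by blast
          show "cmod (f i y - f j y) \<le> e * (s/4)" if "y \<in> cball x (s/4)" for y
            using N sub that \<open>i \<ge> N\<close> \<open>j \<ge> N\<close> \<open>x \<in> B\<close> by blast
          show "((\<lambda>z. f i z - f j z) has_derivative (\<lambda>h. L i x h - L j x h)) (at x)"
            using that BS by (intro has_derivative_diff L) auto
          show "L i x (c *s v) - L j x (c *s v) = c * (L i x v - L j x v)" for c v
            using that BS by (auto simp: L(2) algebra_simps subset_iff)
        qed (use s in auto)
        then show ?thesis using s by simp
      qed
      then show ?thesis by blast
    qed
    define G where "G = (\<lambda>x h. lim (\<lambda>k. L k x h))"
    have G: "(\<lambda>k. L k x h) \<longlonglongrightarrow> G x h" if x: "x \<in> B" for x h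
    proof -
      have "\<exists>N. \<forall>i\<ge>N. \<forall>j\<ge>N. cmod (L i x h - L j x h) < e" if "e > 0" for e
      proof -
        have pos: "e / (norm h + 1) > 0" using that by (simp add: add_nonneg_pos)
        have "e / (norm h + 1) * norm h < e"
          using that by (simp add: divide_simps add_nonneg_pos)
        then show ?thesis using derC[OF pos] x by (meson le_less_trans)
      qed
      then have "Cauchy (\<lambda>k. L k x h)" unfolding Cauchy_iff by blast
      then show ?thesis by (simp add: G_def Cauchy_convergent_iff convergent_LIMSEQ_iff)
    qed
    have "\<exists>g. \<forall>x\<in>B. (\<lambda>k. f k x) \<longlonglongrightarrow> g x \<and> (g has_derivative G x) (at x within B)"
    proof (rule has_derivative_sequence[where ?x0.0=z0 and l="F z0" and f'=L])
      show "convex B" by (simp add: B_def)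
      show "z0 \<in> B" using s by (simp add: B_def)
      show "(\<lambda>n. f n z0) \<longlonglongrightarrow> F z0" by (rule lim[OF z0])
      show "(f n has_derivative L n x) (at x within B)" if "x \<in> B" for n x
        using L(1) BS that has_derivative_at_withinI by blast
      show "\<forall>\<^sub>F n in sequentially. \<forall>x\<in>B. \<forall>h. norm (L n x h - G x h) \<le> e * norm h" if e: "e > 0" for e
      proof -
        obtain N where N: "\<And>i j x h. i \<ge> N \<Longrightarrow> j \<ge> N \<Longrightarrow> x \<in> B \<Longrightarrow> cmod (L i x h - L j x h) \<le> e * norm h"
          using derC[OF e] by blast
        have "norm (L n x h - G x h) \<le> e * norm h" if "n \<ge> N" "x \<in> B" for n x h
        proof (rule LIMSEQ_le_const2)
          show "(\<lambda>j. norm (L n x h - L j x h)) \<longlonglongrightarrow> norm (L n x h - G x h)"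
            by (intro tendsto_intros G that)
          show "\<exists>M. \<forall>j\<ge>M. norm (L n x h - L j x h) \<le> e * norm h"
            using N that by blast
        qed
        then show ?thesis unfolding eventually_sequentially by blast
      qed
    qed
    then obtain g where g: "\<And>x. x \<in> B \<Longrightarrow> (\<lambda>k. f k x) \<longlonglongrightarrow> g x"
        "\<And>x. x \<in> B \<Longrightarrow> (g has_derivative G x) (at x within B)"
      by blast
    have z0B: "z0 \<in> B" "open B" using s by (auto simp: B_def)
    have eq: "g x = F x" if "x \<in> B" for x
      using g(1) lim that BS LIMSEQ_unique by blast
    have "(g has_derivative G z0) (at z0)"
      using g(2) z0B at_within_open by metis
    then have "(F has_derivative G z0) (at z0)"
      by (rule has_derivative_transform_within_open[OF _ z0B(2) z0B(1) eq])
    moreover have "G z0 (c *s v) = c * G z0 v" for c v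
    proof (rule LIMSEQ_unique)
      show "(\<lambda>k. L k z0 (c *s v)) \<longlonglongrightarrow> G z0 (c *s v)" by (rule G[OF z0B(1)])
      show "(\<lambda>k. L k z0 (c *s v)) \<longlonglongrightarrow> c * G z0 v"
        unfolding L(2)[OF z0] by (intro tendsto_intros G z0B)
    qed
    ultimately show "\<exists>L. (F has_derivative L) (at z0) \<and> (\<forall>c v. L (c *s v) = c * L v)"
      by blast
  qed
qed

section \<open>The mean value inequality over balls\<close>

text \<open>
Lebesgue measure is invariant under bijective linear isometries \<open>T\<close>. The proof is that of the
uniqueness of Haar measure: evaluate \<open>\<integral>\<integral> g(y) f(T x + y) dx dy\<close>, with \<open>g\<close> the indicator of the unit
ball, in both orders. Absorbing \<open>y\<close> by a translation in \<open>x\<close> gives \<open>\<integral> f \<circ> T\<close> times the volume \<open>V\<close> of the ball.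
Translating \<open>y\<close> first gives \<open>\<integral>\<integral> g(y - T x) f(y) dx dy\<close>, whose inner integral is again \<open>V\<close>
because \<open>T\<close> preserves balls.
\<close>

lemma nn_integral_lborel_isometry:
  fixes T T' :: "'a::euclidean_space \<Rightarrow> 'a" and f :: "'a \<Rightarrow> ennreal"
  assumes lin: "linear T" and iso: "\<And>x. norm (T x) = norm x" and inv: "\<And>x. T (T' x) = x"
    and f [measurable]: "f \<in> borel_measurable borel"
  shows "(\<integral>\<^sup>+x. f (T x) \<partial>lborel) = (\<integral>\<^sup>+x. f x \<partial>lborel)"
proof -
  have T [measurable]: "T \<in> borel \<rightarrow>\<^sub>M borel"
    by (intro borel_measurable_continuous_onI linear_continuous_on) (use lin linear_conv_bounded_linear in blast)
  let ?g = "indicator (ball 0 1) :: 'a \<Rightarrow> ennreal"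
  let ?V = "emeasure lborel (ball (0::'a) 1)"
  have [measurable]: "ball (0::'a) 1 \<in> sets borel" by simp
  have mult_V: "(\<integral>\<^sup>+y. ?g y * c \<partial>lborel) = c * ?V" for c
  proof -
    have "(\<integral>\<^sup>+y. ?g y * c \<partial>lborel) = integral\<^sup>N lborel ?g * c"
      by (rule nn_integral_multc) measurable
    also have "integral\<^sup>N lborel ?g = ?V"
      by (rule nn_integral_indicator) simp
    finally show ?thesis by (simp only: mult.commute)
  qed
  have shift: "(\<integral>\<^sup>+x. h (x + a) \<partial>lborel) = (\<integral>\<^sup>+x. h x \<partial>lborel)"
    if [measurable]: "h \<in> borel_measurable borel" for h :: "'a \<Rightarrow> ennreal" and a
  proof -
    have "(\<integral>\<^sup>+x. h x \<partial>lborel) = (\<integral>\<^sup>+x. h x \<partial>distr lborel borel ((+) a))"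
      by (simp add: lborel_distr_plus)
    also have "\<dots> = (\<integral>\<^sup>+x. h (a + x) \<partial>lborel)"
      by (rule nn_integral_distr) auto
    finally show ?thesis by (simp add: add.commute)
  qed
  have "(\<integral>\<^sup>+x. f (T x) \<partial>lborel) * ?V = (\<integral>\<^sup>+y. ?g y * (\<integral>\<^sup>+x. f (T x) \<partial>lborel) \<partial>lborel)"
    by (rule mult_V[symmetric])
  also have "\<dots> = (\<integral>\<^sup>+y. ?g y * (\<integral>\<^sup>+x. f (T x + y) \<partial>lborel) \<partial>lborel)"
  proof -
    have "(\<integral>\<^sup>+x. f (T x) \<partial>lborel) = (\<integral>\<^sup>+x. f (T x + y) \<partial>lborel)" for y
    proof -
    have "(\<integral>\<^sup>+x. f (T x + y) \<partial>lborel) = (\<integral>\<^sup>+x. f (T (x + T' y)) \<partial>lborel)"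
      by (simp add: linear_add[OF lin] inv)
    also have "\<dots> = (\<integral>\<^sup>+x. f (T x) \<partial>lborel)" by (rule shift) simp
    finally show "(\<integral>\<^sup>+x. f (T x) \<partial>lborel) = (\<integral>\<^sup>+x. f (T x + y) \<partial>lborel)" ..
    qed
    then show ?thesis by presburger
  qed
  also have "\<dots> = (\<integral>\<^sup>+y. (\<integral>\<^sup>+x. ?g y * f (T x + y) \<partial>lborel) \<partial>lborel)"
    by (simp add: nn_integral_cmult)
  also have "\<dots> = (\<integral>\<^sup>+x. (\<integral>\<^sup>+y. ?g y * f (T x + y) \<partial>lborel) \<partial>lborel)"
    by (rule lborel_pair.Fubini') simp
  also have "\<dots> = (\<integral>\<^sup>+x. (\<integral>\<^sup>+y. ?g (y - T x) * f y \<partial>lborel) \<partial>lborel)"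
  proof (rule nn_integral_cong)
    fix x
    show "(\<integral>\<^sup>+y. ?g y * f (T x + y) \<partial>lborel) = (\<integral>\<^sup>+y. ?g (y - T x) * f y \<partial>lborel)"
      using shift[of "\<lambda>y. ?g (y - T x) * f y" "T x"] by (simp add: add.commute)
  qed
  also have "\<dots> = (\<integral>\<^sup>+y. (\<integral>\<^sup>+x. ?g (y - T x) * f y \<partial>lborel) \<partial>lborel)"
    by (rule lborel_pair.Fubini'[symmetric]) simp
  also have "\<dots> = (\<integral>\<^sup>+y. f y * ?V \<partial>lborel)"
  proof (rule nn_integral_cong)
    fix y
    have "?g (y - T x) = ?g (x + - T' y)" for x
    proof -
      have "y - T x = - T (x + - T' y)"
        by (simp add: linear_add[OF lin] linear_diff[OF lin] inv)
      then have "norm (y - T x) = norm (x + - T' y)" by (metis iso norm_minus_cancel)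
      then show ?thesis by (simp add: indicator_def)
    qed
    then have "(\<integral>\<^sup>+x. ?g (y - T x) * f y \<partial>lborel) = (\<integral>\<^sup>+x. ?g (x + - T' y) * f y \<partial>lborel)"
      by simp
    also have "\<dots> = (\<integral>\<^sup>+x. ?g x * f y \<partial>lborel)" by (rule shift) simp
    finally show "(\<integral>\<^sup>+x. ?g (y - T x) * f y \<partial>lborel) = f y * ?V"
      by (simp only: mult_V)
  qed
  also have "\<dots> = (\<integral>\<^sup>+y. f y \<partial>lborel) * ?V"
    by (rule nn_integral_multc) simp
  finally have "(\<integral>\<^sup>+x. f (T x) \<partial>lborel) * ?V = (\<integral>\<^sup>+y. f y \<partial>lborel) * ?V" .
  moreover have "?V \<noteq> 0" "?V \<noteq> \<infinity>"
    using emeasure_lborel_ball_finite[of "0::'a" 1] 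
      less_imp_neq[OF unit_ball_vol_pos[of "real DIM('a)"]]
    by (auto simp: emeasure_ball)
  ultimately show ?thesis
    by (simp add: ennreal_mult_cancel_left mult.commute[of _ ?V])
qed

text \<open>
Cauchy's integral formula at the centre of the disc.
\<close>

lemma circle_mean_value_inequality:
  assumes g: "g holomorphic_on cball 0 1"
  shows "ennreal (cmod (g 0)) \<le>
    (\<integral>\<^sup>+t. ennreal (cmod (g (exp (2 * of_real pi * \<i> * of_real t)))) * indicator {0..1} t \<partial>lborel)"
proof -
  define e where "e = (\<lambda>t::real. exp (2 * of_real pi * \<i> * of_real t))"
  have e: "cmod (e t) = 1" for t
    by (simp add: e_def norm_exp)
  have "((\<lambda>u. g u / (u - 0)) has_contour_integral (2 * of_real pi * \<i> * g 0)) (circlepath 0 1)"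
    using g by (intro Cauchy_integral_circlepath_simple) auto
  then have "((\<lambda>t. g (e t) / e t * (2 * of_real pi * \<i> * e t)) has_integral (2 * of_real pi * \<i> * g 0)) {0..1}"
    unfolding has_contour_integral
    by (simp only: vector_derivative_circlepath) (simp add: circlepath e_def)
  moreover define a where "a = 2 * of_real pi * \<i>"
  ultimately have int_a: "((\<lambda>t. a * g (e t)) has_integral a * g 0) {0..1}"
    by (simp add: e_def mult_ac)
  have "a \<noteq> 0" by (simp add: a_def)
  from has_integral_mult_right[OF int_a, of "inverse a"]
  have int: "((\<lambda>t. g (e t)) has_integral g 0) {0..1}"
    by (simp add: mult.assoc[symmetric] \<open>a \<noteq> 0\<close>)
  have cont: "continuous_on {0..1} (\<lambda>t. g (e t))"
    using e unfolding e_def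
    by (intro continuous_on_compose2[OF holomorphic_on_imp_continuous_on[OF g]] continuous_intros) auto
  have intn: "(\<lambda>t. cmod (g (e t))) integrable_on {0..1}"
    by (intro integrable_continuous_real continuous_intros cont)
  have "cmod (g 0) \<le> integral {0..1} (\<lambda>t. cmod (g (e t)))"
    using integral_norm_bound_integral[OF _ intn, of "\<lambda>t. g (e t)"] int
    by (metis has_integral_integrable integral_unique order_refl)
  then have "ennreal (cmod (g 0)) \<le> ennreal (integral {0..1} (\<lambda>t. cmod (g (e t))))"
    by (rule ennreal_leI)
  also have "\<dots> = (\<integral>\<^sup>+t. ennreal (cmod (g (e t))) * indicator {0..1} t \<partial>lborel)"
    by (intro nn_integral_has_integral_lebesgue'[symmetric] integrable_integral intn) auto
  finally show ?thesis by (simp add: e_def)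
qed

text \<open>
On each circle \<open>z + e\<^sup>i\<^sup>t w\<close> the one-variable inequality holds. Integrating it over \<open>w\<close> in the ball and
exchanging the integrals leaves, for each \<open>t\<close>, the integral of \<open>|f|\<close> over a rotated ball, which does
not depend on \<open>t\<close> since multiplication by a unimodular scalar is an isometry.
\<close>

lemma ball_mean_value_inequality:
  fixes z :: "complex^'n"
  assumes f: "holomorphic_fun_on f S" and sub: "ball z r \<subseteq> S"
  shows "ennreal (cmod (f z)) * emeasure lborel (ball z r) \<le>
    (\<integral>\<^sup>+w. ennreal (cmod (f w)) * indicator (ball z r) w \<partial>lborel)"
proof -
  define h where "h = (\<lambda>w. ennreal (indicator (ball z r) w *\<^sub>R cmod (f w)))"
  define e where "e = (\<lambda>t::real. exp (2 * of_real pi * \<i> * of_real t))"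
  have e: "cmod (e t) = 1" for t by (simp add: e_def norm_exp)
  have h [measurable]: "h \<in> borel_measurable borel"
    unfolding h_def
    by (intro measurable_compose[OF _ measurable_ennreal] borel_measurable_continuous_on_indicator
        continuous_intros continuous_on_subset[OF holomorphic_fun_on_continuous_on[OF f]] sub) auto
  have [measurable]: "ball z r \<in> sets borel" by simp
  have h_eq: "h w = ennreal (cmod (f w)) * indicator (ball z r) w" for w
    by (simp add: h_def indicator_def)
  have line [measurable]: "(\<lambda>(t, w). z + e t *s w) \<in> borel_measurable (borel \<Otimes>\<^sub>M borel)"
    unfolding borel_prod e_def case_prod_unfold
    by (intro borel_measurable_continuous_onI) (auto simp: vector_scalar_mult_def intro!: continuous_intros)
  have "ennreal (cmod (f z)) * indicator (ball z r) (z + w) \<le> (\<integral>\<^sup>+t. h (z + e t *s w) * indicator {0..1} t \<partial>lborel)" for w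
  proof (cases "norm w < r")
    case True
    have in_ball: "z + c *s w \<in> ball z r" if "cmod c \<le> 1" for c
    proof -
      have "cmod c * norm w \<le> 1 * norm w" by (intro mult_right_mono that) auto
      then show ?thesis using True by (simp add: dist_norm norm_complex_scale)
    qed
    have "(\<lambda>c. f (z + c *s w)) holomorphic_on cball 0 1"
      using in_ball sub by (intro holomorphic_on_slice[OF f]) auto
    from circle_mean_value_inequality[OF this]
    have "ennreal (cmod (f z)) \<le> (\<integral>\<^sup>+t. ennreal (cmod (f (z + e t *s w))) * indicator {0..1} t \<partial>lborel)"
      by (simp add: e_def)
    also have "\<dots> = (\<integral>\<^sup>+t. h (z + e t *s w) * indicator {0..1} t \<partial>lborel)"
      using in_ball e by (simp add: h_eq)
    finally show ?thesis by (simp add: indicator_def)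
  qed (simp add: dist_norm indicator_def)
  then have "(\<integral>\<^sup>+w. ennreal (cmod (f z)) * indicator (ball z r) (z + w) \<partial>lborel) \<le>
      (\<integral>\<^sup>+w. (\<integral>\<^sup>+t. h (z + e t *s w) * indicator {0..1} t \<partial>lborel) \<partial>lborel)"
    by (intro nn_integral_mono) auto
  also have "\<dots> = (\<integral>\<^sup>+t. (\<integral>\<^sup>+w. h (z + e t *s w) * indicator {0..1} t \<partial>lborel) \<partial>lborel)"
    by (rule lborel_pair.Fubini'[symmetric]) (use line in \<open>simp add: case_prod_unfold\<close>)
  also have "\<dots> = (\<integral>\<^sup>+t. (\<integral>\<^sup>+w. h (z + w) \<partial>lborel) * indicator {0..1::real} t \<partial>lborel)"
  proof (rule nn_integral_cong)
    fix t :: real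
    have lin: "linear (\<lambda>w::complex^'n. e t *s w)"
      by (intro linearI) (simp_all add: vec_eq_iff algebra_simps)
    have "e t * inverse (e t) = 1" using e[of t] by (metis norm_zero right_inverse zero_neq_one)
    then have "(\<integral>\<^sup>+w. h (z + e t *s w) \<partial>lborel) = (\<integral>\<^sup>+w. h (z + w) \<partial>lborel)"
      by (intro nn_integral_lborel_isometry[OF lin, of "\<lambda>w. inverse (e t) *s w"])
        (auto simp: norm_complex_scale e vector_smult_assoc)
    then show "(\<integral>\<^sup>+w. h (z + e t *s w) * indicator {0..1} t \<partial>lborel) = (\<integral>\<^sup>+w. h (z + w) \<partial>lborel) * indicator {0..1} t"
      by (simp add: indicator_def)
  qed
  also have "\<dots> = (\<integral>\<^sup>+w. h (z + w) \<partial>lborel)"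
    by (simp add: nn_integral_cmult)
  also have "\<dots> = (\<integral>\<^sup>+w. h w \<partial>distr lborel borel ((+) z))"
    by (rule nn_integral_distr[symmetric]) auto
  also have "\<dots> = (\<integral>\<^sup>+w. h w \<partial>lborel)" by (simp add: lborel_distr_plus)
  finally have "(\<integral>\<^sup>+w. ennreal (cmod (f z)) * indicator (ball z r) (z + w) \<partial>lborel) \<le> (\<integral>\<^sup>+w. h w \<partial>lborel)" .
  moreover have "(\<integral>\<^sup>+w. ennreal (cmod (f z)) * indicator (ball z r) (z + w) \<partial>lborel)
      = (\<integral>\<^sup>+w. ennreal (cmod (f z)) * indicator (ball z r) w \<partial>distr lborel borel ((+) z))"
    by (rule nn_integral_distr[symmetric]) measurable
  ultimately show ?thesis
    by (simp add: lborel_distr_plus nn_integral_cmult h_eq)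
qed

section \<open>Completeness of \<open>L\<^sup>p\<close>\<close>

text \<open>
The \<open>p\<close>-th power of the seminorm, with value \<open>\<infinity>\<close> at measurable functions outside \<open>L\<^sup>p\<close>, where
the real-valued \<open>Lp_norm\<close> is \<open>0\<close>.
\<close>

definition Lp_power :: "real \<Rightarrow> 'a measure \<Rightarrow> ('a \<Rightarrow> complex) \<Rightarrow> ennreal" where
  "Lp_power p M f = (\<integral>\<^sup>+x. ennreal (cmod (f x) powr p) \<partial>M)"

lemma Lp_space_iff: "f \<in> Lp_space p M \<longleftrightarrow> f \<in> borel_measurable M \<and> Lp_power p M f < \<infinity>"
  by (auto simp: Lp_space_def Lp_power_def integrable_iff_bounded)

lemma Lp_norm_eq: "f \<in> borel_measurable M \<Longrightarrow> Lp_norm p M f = enn2real (Lp_power p M f) powr (1 / p)"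
  unfolding Lp_norm_def Lp_power_def by (subst integral_eq_nn_integral) auto

lemma Lp_power_diff_commute: "Lp_power p M (\<lambda>x. f x - g x) = Lp_power p M (\<lambda>x. g x - f x)"
  by (simp add: Lp_power_def norm_minus_commute)

lemma powr_add_le:
  fixes x y p :: real
  assumes "0 \<le> x" "0 \<le> y" "0 \<le> p"
  shows "(x + y) powr p \<le> 2 powr p * (x powr p + y powr p)"
proof -
  have "(x + y) powr p \<le> (2 * max x y) powr p"
    using assms by (intro powr_mono2) auto
  also have "\<dots> = 2 powr p * max x y powr p"
    using assms by (simp add: powr_mult)
  also have "\<dots> \<le> 2 powr p * (x powr p + y powr p)"
    by (intro mult_left_mono) (auto simp: max_def)
  finally show ?thesis .
qed

text \<open>
The constant \<open>2\<^sup>p\<close> is harmless: the inequality serves to compare Cauchy with convergent sequences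
and to close \<open>L\<^sup>p\<close> under differences.
\<close>

lemma Lp_power_triangle:
  assumes p: "0 \<le> p"
    and [measurable]: "f \<in> borel_measurable M" "g \<in> borel_measurable M" "h \<in> borel_measurable M"
  shows "Lp_power p M (\<lambda>x. f x - g x) \<le>
    ennreal (2 powr p) * (Lp_power p M (\<lambda>x. f x - h x) + Lp_power p M (\<lambda>x. h x - g x))"
proof -
  have "Lp_power p M (\<lambda>x. f x - g x) \<le>
      (\<integral>\<^sup>+x. ennreal (2 powr p) * (ennreal (cmod (f x - h x) powr p) + ennreal (cmod (h x - g x) powr p)) \<partial>M)"
    unfolding Lp_power_def
  proof (rule nn_integral_mono)
    fix x
    have "cmod (f x - g x) \<le> cmod (f x - h x) + cmod (h x - g x)"
      by (metis diff_add_cancel add_diff_eq norm_triangle_ineq)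
    then have "cmod (f x - g x) powr p \<le> (cmod (f x - h x) + cmod (h x - g x)) powr p"
      by (intro powr_mono2 p) auto
    also have "\<dots> \<le> 2 powr p * (cmod (f x - h x) powr p + cmod (h x - g x) powr p)"
      by (intro powr_add_le p) auto
    finally show "ennreal (cmod (f x - g x) powr p) \<le>
        ennreal (2 powr p) * (ennreal (cmod (f x - h x) powr p) + ennreal (cmod (h x - g x) powr p))"
      by (simp flip: ennreal_plus ennreal_mult)
  qed
  then show ?thesis
    by (simp add: Lp_power_def nn_integral_cmult nn_integral_add)
qed

lemma Lp_space_diff:
  assumes p: "0 \<le> p" and f: "f \<in> Lp_space p M" and g: "g \<in> Lp_space p M"
  shows "(\<lambda>x. f x - g x) \<in> Lp_space p M"
proof -
  have [measurable]: "f \<in> borel_measurable M" "g \<in> borel_measurable M"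
    using f g by (auto simp: Lp_space_iff)
  have "Lp_power p M (\<lambda>x. f x - g x) \<le> ennreal (2 powr p) * (Lp_power p M (\<lambda>x. f x - 0) + Lp_power p M (\<lambda>x. 0 - g x))"
    by (intro Lp_power_triangle p) auto
  also have "\<dots> = ennreal (2 powr p) * (Lp_power p M f + Lp_power p M g)"
    by (simp add: Lp_power_def)
  also have "\<dots> < \<infinity>"
    using f g by (simp add: Lp_space_iff ennreal_mult_less_top)
  finally show ?thesis by (simp add: Lp_space_iff)
qed

lemma Lp_norm_tendsto_0_iff:
  assumes p: "0 < p" and u: "\<And>k. u k \<in> Lp_space p M"
  shows "(\<lambda>k. Lp_norm p M (u k)) \<longlonglongrightarrow> 0 \<longleftrightarrow> (\<lambda>k. Lp_power p M (u k)) \<longlonglongrightarrow> 0"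
proof -
  define I where "I k = enn2real (Lp_power p M (u k))" for k
  have I: "Lp_power p M (u k) = ennreal (I k)" "I k \<ge> 0" for k
    using u[of k] by (auto simp: Lp_space_iff I_def)
  have N: "Lp_norm p M (u k) = I k powr (1 / p)" for k
    using u[of k] by (simp add: Lp_norm_eq Lp_space_iff I_def)
  have "(\<lambda>k. I k powr (1 / p)) \<longlonglongrightarrow> 0 \<longleftrightarrow> I \<longlonglongrightarrow> 0"
  proof
    assume "(\<lambda>k. I k powr (1 / p)) \<longlonglongrightarrow> 0"
    then have "(\<lambda>k. (I k powr (1 / p)) powr p) \<longlonglongrightarrow> 0 powr p"
      using p by (intro tendsto_powr') (auto intro!: always_eventually)
    then show "I \<longlonglongrightarrow> 0" using p I by (simp add: powr_powr)
  next
    assume "I \<longlonglongrightarrow> 0"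
    then have "(\<lambda>k. I k powr (1 / p)) \<longlonglongrightarrow> 0 powr (1 / p)"
      using p I by (intro tendsto_powr') (auto intro!: always_eventually)
    then show "(\<lambda>k. I k powr (1 / p)) \<longlonglongrightarrow> 0" by simp
  qed
  also have "I \<longlonglongrightarrow> 0 \<longleftrightarrow> (\<lambda>k. ennreal (I k)) \<longlonglongrightarrow> ennreal 0"
    using I by (subst tendsto_ennreal_iff) auto
  finally show ?thesis by (simp add: N I)
qed

definition Lp_Cauchy :: "real \<Rightarrow> 'a measure \<Rightarrow> (nat \<Rightarrow> 'a \<Rightarrow> complex) \<Rightarrow> bool" where
  "Lp_Cauchy p M u \<longleftrightarrow>
     (\<forall>e>0. \<exists>N. \<forall>i\<ge>N. \<forall>j\<ge>N. Lp_power p M (\<lambda>x. u i x - u j x) \<le> ennreal e)"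

lemma Lp_convergent_imp_Cauchy:
  assumes p: "0 \<le> p" and u: "\<And>k. u k \<in> borel_measurable M" and g: "g \<in> borel_measurable M"
    and lim: "(\<lambda>k. Lp_power p M (\<lambda>x. u k x - g x)) \<longlonglongrightarrow> 0"
  shows "Lp_Cauchy p M u"
  unfolding Lp_Cauchy_def
proof (intro allI impI)
  fix e :: real assume e: "e > 0"
  define d where "d = e / (2 * 2 powr p)"
  have d: "d > 0" using e by (simp add: d_def)
  then have "eventually (\<lambda>k. Lp_power p M (\<lambda>x. u k x - g x) < ennreal d) sequentially"
    using lim by (intro order_tendstoD(2)) auto
  then obtain N where N: "\<And>k. k \<ge> N \<Longrightarrow> Lp_power p M (\<lambda>x. u k x - g x) < ennreal d"
    unfolding eventually_sequentially by blast
  have "Lp_power p M (\<lambda>x. u i x - u j x) \<le> ennreal e" if "i \<ge> N" "j \<ge> N" for i j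
  proof -
    have "Lp_power p M (\<lambda>x. u i x - u j x) \<le>
        ennreal (2 powr p) * (Lp_power p M (\<lambda>x. u i x - g x) + Lp_power p M (\<lambda>x. g x - u j x))"
      by (intro Lp_power_triangle p u g)
    also have "\<dots> \<le> ennreal (2 powr p) * (ennreal d + ennreal d)"
      using N[OF that(1)] N[OF that(2)] Lp_power_diff_commute[of p M g "u j"]
      by (intro mult_left_mono add_mono) auto
    also have "\<dots> = ennreal e"
      using d by (simp add: d_def field_simps flip: ennreal_plus ennreal_mult)
    finally show ?thesis .
  qed
  then show "\<exists>N. \<forall>i\<ge>N. \<forall>j\<ge>N. Lp_power p M (\<lambda>x. u i x - u j x) \<le> ennreal e" by blast
qed

text \<open>
Fatou's lemma.
\<close>

lemma Lp_power_lower_semicontinuous: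
  assumes p: "0 < p" and v: "\<And>k. v k \<in> borel_measurable M"
    and lim: "AE x in M. (\<lambda>k. v k x) \<longlonglongrightarrow> g x"
    and bound: "eventually (\<lambda>k. Lp_power p M (v k) \<le> c) sequentially"
  shows "Lp_power p M g \<le> c"
proof -
  have "Lp_power p M g = (\<integral>\<^sup>+x. liminf (\<lambda>k. ennreal (cmod (v k x) powr p)) \<partial>M)"
    unfolding Lp_power_def
  proof (intro nn_integral_cong_AE eventually_mono[OF lim])
    fix x assume "(\<lambda>k. v k x) \<longlonglongrightarrow> g x"
    then have "(\<lambda>k. ennreal (cmod (v k x) powr p)) \<longlonglongrightarrow> ennreal (cmod (g x) powr p)"
      using p by (intro tendsto_ennrealI tendsto_powr' tendsto_norm) (auto intro!: always_eventually)
    then show "ennreal (cmod (g x) powr p) = liminf (\<lambda>k. ennreal (cmod (v k x) powr p))"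
      by (metis lim_imp_Liminf sequentially_bot)
  qed
  also have "\<dots> \<le> liminf (\<lambda>k. Lp_power p M (v k))"
    unfolding Lp_power_def using v by (intro nn_integral_liminf) measurable
  also have "\<dots> \<le> liminf (\<lambda>k. c)"
    by (rule Liminf_mono[OF bound])
  also have "\<dots> = c" by (simp add: Liminf_const)
  finally show ?thesis .
qed

text \<open>
Fatou's lemma along the subsequence, applied to \<open>u i - u (r k)\<close> for fixed \<open>i\<close>, bounds the distance from
\<open>u i\<close> to the pointwise limit by the Cauchy bound.
\<close>

lemma Lp_Cauchy_AE_limit:
  assumes p: "0 < p" and u: "\<And>k. u k \<in> Lp_space p M" and g: "g \<in> borel_measurable M"
    and cauchy: "Lp_Cauchy p M u"
    and r: "strict_mono r" and lim: "AE x in M. (\<lambda>k. u (r k) x) \<longlonglongrightarrow> g x"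
  shows "g \<in> Lp_space p M" and "(\<lambda>k. Lp_power p M (\<lambda>x. u k x - g x)) \<longlonglongrightarrow> 0"
proof -
  have [measurable]: "u k \<in> borel_measurable M" for k using u by (simp add: Lp_space_iff)
  have tail: "\<exists>N. \<forall>i\<ge>N. Lp_power p M (\<lambda>x. u i x - g x) \<le> ennreal e" if e: "e > 0" for e
  proof -
    obtain N where N: "\<And>i j. i \<ge> N \<Longrightarrow> j \<ge> N \<Longrightarrow> Lp_power p M (\<lambda>x. u i x - u j x) \<le> ennreal e"
      using cauchy e unfolding Lp_Cauchy_def by blast
    have "Lp_power p M (\<lambda>x. u i x - g x) \<le> ennreal e" if i: "i \<ge> N" for i
    proof (rule Lp_power_lower_semicontinuous[OF p])
      show "AE x in M. (\<lambda>k. u i x - u (r k) x) \<longlonglongrightarrow> u i x - g x"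
        using lim by eventually_elim (intro tendsto_intros)
      show "eventually (\<lambda>k. Lp_power p M (\<lambda>x. u i x - u (r k) x) \<le> ennreal e) sequentially"
        using eventually_ge_at_top[of N]
      proof eventually_elim
        case (elim k)
        then show ?case using N i seq_suble[OF r, of k] by (meson order_trans)
      qed
    qed measurable
    then show ?thesis by blast
  qed
  show "(\<lambda>k. Lp_power p M (\<lambda>x. u k x - g x)) \<longlonglongrightarrow> 0"
  proof (rule order_tendstoI)
    fix a :: ennreal assume "0 < a"
    then obtain e where e: "0 < ennreal e" "ennreal e < a"
      by (metis dense ennreal_cases infinity_ennreal_def not_less_iff_gr_or_eq top.not_eq_extremum)
    then show "\<forall>\<^sub>F k in sequentially. Lp_power p M (\<lambda>x. u k x - g x) < a"
      using tail[of e] unfolding eventually_sequentially by (meson ennreal_less_zero_iff le_less_trans)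
  qed simp
  obtain N where "Lp_power p M (\<lambda>x. u N x - g x) \<le> ennreal 1" using tail[of 1] by auto
  then have "(\<lambda>x. u N x - g x) \<in> Lp_space p M"
    using g by (auto simp: Lp_space_iff intro: le_less_trans)
  from Lp_space_diff[OF _ u[of N] this] p show "g \<in> Lp_space p M" by simp
qed

text \<open>
Linear control by the \<open>p\<close>-th power up to an error \<open>t\<close>. As \<open>t\<close> is fixed before the \<open>p\<close>-th power becomes
small, smallness of integrals of \<open>|f|\<^sup>p\<close> over sets of finite measure implies smallness of those of \<open>|f|\<close>.
\<close>

lemma le_add_powr:
  fixes x t p :: real
  assumes "0 \<le> x" "0 < t" "1 \<le> p"
  shows "x \<le> t + t powr (1 - p) * x powr p"
proof (cases "x \<le> t")
  case True
  then show ?thesis by (simp add: add_increasing2)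
next
  case False
  then have x: "x > 0" using assms by linarith
  have "x powr (1 - p) \<le> t powr (1 - p)"
    using False assms by (intro powr_mono2') auto
  then have "x powr (1 - p) * x powr p \<le> t powr (1 - p) * x powr p"
    by (intro mult_right_mono) auto
  moreover have "x powr (1 - p) * x powr p = x" using x by (simp flip: powr_add)
  ultimately show ?thesis using assms by linarith
qed

text \<open>
The Riesz--Fischer theorem. Integrating \<open>le_add_powr\<close> over the finite measure shows that the sequence
is also Cauchy in \<open>L\<^sup>1\<close>, where almost everywhere convergent subsequences exist.
\<close>

lemma Lp_complete:
  assumes p: "1 \<le> p" and fin: "finite_measure M"
    and u: "\<And>k. u k \<in> Lp_space p M" and cauchy: "Lp_Cauchy p M u"
  obtains g where "g \<in> Lp_space p M" "(\<lambda>k. Lp_power p M (\<lambda>x. u k x - g x)) \<longlonglongrightarrow> 0"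
proof -
  interpret finite_measure M by (rule fin)
  have [measurable]: "u k \<in> borel_measurable M" for k using u by (simp add: Lp_space_iff)
  have Lp: "integrable M (\<lambda>x. cmod (v x) powr p)" if "v \<in> Lp_space p M" for v
    using that by (simp add: Lp_space_def)
  have L1: "integrable M v" if v: "v \<in> Lp_space p M" for v
  proof (rule Bochner_Integration.integrable_bound)
    show "integrable M (\<lambda>x. 1 + cmod (v x) powr p)" by (intro Bochner_Integration.integrable_add Lp v) simp
    show "v \<in> borel_measurable M" using v by (simp add: Lp_space_iff)
    show "AE x in M. norm (v x) \<le> norm (1 + cmod (v x) powr p)"
      using le_add_powr[of _ 1 p] p by (intro AE_I2) simp
  qed
  have diff: "(\<lambda>x. u i x - u j x) \<in> Lp_space p M" for i j
    using p by (intro Lp_space_diff u) auto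
  have L1_Cauchy: "\<exists>N. \<forall>i\<ge>N. \<forall>j\<ge>N. (LINT x|M. norm (u i x - u j x)) < e" if e: "e > 0" for e :: real
  proof -
    define m where "m = measure M (space M)"
    \<comment> \<open>The error term integrates to at most e/2; the 1 added to the total mass covers the case of a null measure.\<close>
    define t where "t = e / (2 * (m + 1))"
    have m: "m \<ge> 0" by (simp add: m_def)
    have t: "t > 0" using e m by (simp add: t_def)
    have tm: "t * m < e / 2" using e m by (simp add: t_def field_simps)
    define d where "d = (e / 2) / t powr (1 - p)"
    have d: "d > 0" using e t by (simp add: d_def)
    obtain N where N: "\<And>i j. i \<ge> N \<Longrightarrow> j \<ge> N \<Longrightarrow> Lp_power p M (\<lambda>x. u i x - u j x) \<le> ennreal d"
      using cauchy d unfolding Lp_Cauchy_def by blast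
    have "(LINT x|M. norm (u i x - u j x)) < e" if "i \<ge> N" "j \<ge> N" for i j
    proof -
      have "ennreal (LINT x|M. cmod (u i x - u j x) powr p) \<le> ennreal d"
        using N[OF that] Lp[OF diff] by (simp add: Lp_power_def nn_integral_eq_integral)
      then have le: "(LINT x|M. cmod (u i x - u j x) powr p) \<le> d" using d by (simp add: ennreal_le_iff)
      have "(LINT x|M. norm (u i x - u j x)) \<le> (LINT x|M. t + t powr (1 - p) * cmod (u i x - u j x) powr p)"
        using t p by (intro integral_mono le_add_powr integrable_norm L1 diff
            Bochner_Integration.integrable_add integrable_mult_right Lp) auto
      also have "\<dots> = t * m + t powr (1 - p) * (LINT x|M. cmod (u i x - u j x) powr p)"
        using Lp[OF diff[of i j]] by (subst Bochner_Integration.integral_add) (auto simp: m_def)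
      also have "\<dots> \<le> t * m + t powr (1 - p) * d"
        by (intro add_left_mono mult_left_mono le) auto
      also have "\<dots> < e" using tm t by (simp add: d_def)
      finally show ?thesis .
    qed
    then show ?thesis by blast
  qed
  obtain r where r: "strict_mono r" and AE: "AE x in M. Cauchy (\<lambda>k. u (r k) x)"
    using cauchy_L1_AE_cauchy_subseq[of M u, OF L1[OF u] L1_Cauchy] by blast
  define g where "g = (\<lambda>x. lim (\<lambda>k. u (r k) x))"
  have g: "g \<in> borel_measurable M" unfolding g_def by measurable
  have lim: "AE x in M. (\<lambda>k. u (r k) x) \<longlonglongrightarrow> g x"
    using AE by eventually_elim (simp add: g_def Cauchy_convergent_iff convergent_LIMSEQ_iff)
  from p have p0: "0 < p" by simp
  show ?thesis
    using that Lp_Cauchy_AE_limit[OF p0 u g cauchy r lim] by blast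
qed

section \<open>Completeness of Bergman spaces\<close>

text \<open>
Near each point of \<open>\<Omega>\<close>, Lebesgue measure is at most a multiple of \<open>M\<close>. The condition
isolates what bounds point evaluations, so that one completeness theorem serves the unweighted
volume, from which the Bergman kernel is constructed, and the weighted volume defined by that kernel.
\<close>

definition locally_dominates_volume :: "(complex^'n) measure \<Rightarrow> (complex^'n) set \<Rightarrow> bool" where
  "locally_dominates_volume M \<Omega> \<longleftrightarrow> sets M = sets (restrict_space borel \<Omega>) \<and>
     (\<forall>z\<in>\<Omega>. \<exists>r>0. \<exists>C\<ge>0. ball z r \<subseteq> \<Omega> \<and>
       (\<forall>h\<in>borel_measurable M.
          (\<integral>\<^sup>+w. h w * indicator (ball z r) w \<partial>lborel) \<le> ennreal C * (\<integral>\<^sup>+w. h w \<partial>M)))"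

lemma holomorphic_fun_on_borel_measurable:
  assumes "holomorphic_fun_on f \<Omega>" "sets M = sets (restrict_space borel \<Omega>)"
  shows "f \<in> borel_measurable M"
  using borel_measurable_continuous_on_restrict[OF holomorphic_fun_on_continuous_on[OF assms(1)]]
  by (simp add: measurable_cong_sets[OF assms(2) refl])

lemma bergman_space_iff:
  assumes "sets M = sets (restrict_space borel \<Omega>)"
  shows "f \<in> bergman_space \<Omega> p M \<longleftrightarrow> holomorphic_fun_on f \<Omega> \<and> Lp_power p M f < \<infinity>"
  using holomorphic_fun_on_borel_measurable[OF _ assms]
  by (auto simp: bergman_space_def Lp_space_iff)

text \<open>
The mean value inequality over balls of half the radius, whose centres may then vary, combined with
\<open>le_add_powr\<close>. The parameter \<open>t\<close> is kept because different values are best: for \<open>J \<rightarrow> 0\<close> it is fixed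
first, and for \<open>p = 2\<close> the choice \<open>t = \<surd>J\<close> gives a bound by a multiple of \<open>\<surd>J\<close>.
\<close>

lemma local_point_evaluation_bound:
  fixes M :: "(complex^'n) measure"
  assumes dom: "locally_dominates_volume M \<Omega>" and z0: "z0 \<in> \<Omega>" and p: "1 \<le> p"
  obtains r D where "r > 0" "D \<ge> 0" "ball z0 r \<subseteq> \<Omega>"
    "\<And>f z t J. holomorphic_fun_on f \<Omega> \<Longrightarrow> z \<in> ball z0 r \<Longrightarrow> t > 0 \<Longrightarrow> 0 \<le> J \<Longrightarrow>
       Lp_power p M f \<le> ennreal J \<Longrightarrow> cmod (f z) \<le> t + D * t powr (1 - p) * J"
proof -
  have sets: "sets M = sets (restrict_space borel \<Omega>)"
    using dom by (simp add: locally_dominates_volume_def)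
  obtain r0 C where r0: "r0 > 0" "ball z0 r0 \<subseteq> \<Omega>" and C: "C \<ge> 0"
    "\<And>h. h \<in> borel_measurable M \<Longrightarrow>
       (\<integral>\<^sup>+w. h w * indicator (ball z0 r0) w \<partial>lborel) \<le> ennreal C * (\<integral>\<^sup>+w. h w \<partial>M)"
    using dom z0 unfolding locally_dominates_volume_def by blast
  define r where "r = r0 / 2"
  define V where "V = unit_ball_vol (real DIM(complex^'n)) * r ^ DIM(complex^'n)"
  have r: "r > 0" using r0 by (simp add: r_def)
  have V: "V > 0" using r by (simp add: V_def del: DIM_cart)
  have emeasure_V: "emeasure lborel (ball z r) = ennreal V" for z :: "complex^'n"
    using r by (simp add: V_def emeasure_ball del: DIM_cart)
  show ?thesis
  proof (rule that[of r "C / V"])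
    show "ball z0 r \<subseteq> \<Omega>" using r0 by (auto simp: r_def)
    fix f z t J
    assume f: "holomorphic_fun_on f \<Omega>" and z: "z \<in> ball z0 r" and t: "(t::real) > 0" and J: "0 \<le> J"
      and le: "Lp_power p M f \<le> ennreal J"
    have zsub: "ball z r \<subseteq> ball z0 r0"
      using z by (auto simp: r_def) (smt (verit) dist_triangle field_sum_of_halves)
    have meas: "(\<lambda>w. ennreal (cmod (f w) powr p)) \<in> borel_measurable M"
      using holomorphic_fun_on_borel_measurable[OF f sets] by measurable
    have [measurable]: "ball z r \<in> sets borel" by simp
    have meas_ball: "(\<lambda>w. ennreal (cmod (f w) powr p) * indicator (ball z r) w) \<in> borel_measurable borel"
    proof -
      have cont: "continuous_on (ball z r) f"
        using holomorphic_fun_on_continuous_on[OF f] zsub r0 continuous_on_subset by blast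
      have [measurable]: "(\<lambda>w. indicator (ball z r) w *\<^sub>R f w) \<in> borel_measurable borel"
        by (rule borel_measurable_continuous_on_indicator[OF _ cont]) simp
      have "(\<lambda>w. ennreal (cmod (indicator (ball z r) w *\<^sub>R f w) powr p)) \<in> borel_measurable borel"
        by measurable
      also have "(\<lambda>w. ennreal (cmod (indicator (ball z r) w *\<^sub>R f w) powr p)) =
          (\<lambda>w. ennreal (cmod (f w) powr p) * indicator (ball z r) w)"
        by (auto simp: indicator_def)
      finally show ?thesis .
    qed
    have "ennreal (cmod (f z)) * ennreal V \<le> (\<integral>\<^sup>+w. ennreal (cmod (f w)) * indicator (ball z r) w \<partial>lborel)"
      using ball_mean_value_inequality[OF f order_trans[OF zsub r0(2)]] by (simp only: emeasure_V)
    also have "\<dots> \<le> (\<integral>\<^sup>+w. ennreal t * indicator (ball z r) w +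
        ennreal (t powr (1 - p)) * (ennreal (cmod (f w) powr p) * indicator (ball z r) w) \<partial>lborel)"
    proof (rule nn_integral_mono)
      fix w
      have "ennreal (cmod (f w)) \<le> ennreal (t + t powr (1 - p) * cmod (f w) powr p)"
        using le_add_powr[of "cmod (f w)" t p] t p by (intro ennreal_leI) auto
      also have "\<dots> = ennreal t + ennreal (t powr (1 - p)) * ennreal (cmod (f w) powr p)"
        using t by (simp add: ennreal_plus ennreal_mult)
      finally show "ennreal (cmod (f w)) * indicator (ball z r) w \<le> ennreal t * indicator (ball z r) w +
          ennreal (t powr (1 - p)) * (ennreal (cmod (f w) powr p) * indicator (ball z r) w)"
        by (simp add: indicator_def)
    qed
    also have "\<dots> = (\<integral>\<^sup>+w. ennreal t * indicator (ball z r) w \<partial>lborel) +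
        ennreal (t powr (1 - p)) * (\<integral>\<^sup>+w. ennreal (cmod (f w) powr p) * indicator (ball z r) w \<partial>lborel)"
      using meas_ball by (subst nn_integral_add) (auto simp: nn_integral_cmult)
    also have "\<dots> = ennreal t * ennreal V +
        ennreal (t powr (1 - p)) * (\<integral>\<^sup>+w. ennreal (cmod (f w) powr p) * indicator (ball z r) w \<partial>lborel)"
      by (simp add: nn_integral_cmult_indicator emeasure_V)
    also have "\<dots> \<le> ennreal t * ennreal V + ennreal (t powr (1 - p)) * (ennreal C * ennreal J)"
    proof (intro add_left_mono mult_left_mono)
      have "(\<integral>\<^sup>+w. ennreal (cmod (f w) powr p) * indicator (ball z r) w \<partial>lborel) \<le>
          (\<integral>\<^sup>+w. ennreal (cmod (f w) powr p) * indicator (ball z0 r0) w \<partial>lborel)"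
        using zsub by (intro nn_integral_mono mult_left_mono) (auto simp: indicator_def)
      also have "\<dots> \<le> ennreal C * Lp_power p M f"
        unfolding Lp_power_def by (rule C(2)[OF meas])
      also have "\<dots> \<le> ennreal C * ennreal J" by (intro mult_left_mono le) auto
      finally show "(\<integral>\<^sup>+w. ennreal (cmod (f w) powr p) * indicator (ball z r) w \<partial>lborel) \<le> ennreal C * ennreal J" .
    qed auto
    also have "\<dots> = ennreal (t * V + t powr (1 - p) * (C * J))"
      using t V C J by (simp add: ennreal_plus ennreal_mult)
    also have "ennreal (cmod (f z)) * ennreal V = ennreal (cmod (f z) * V)"
      using V by (simp add: ennreal_mult)
    finally have "cmod (f z) * V \<le> t * V + t powr (1 - p) * (C * J)"
      using t V C J by (subst (asm) ennreal_le_iff) auto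
    then show "cmod (f z) \<le> t + C / V * t powr (1 - p) * J"
      using V by (simp add: field_simps)
  qed (use r C V in auto)
qed

text \<open>
Locally bounded point evaluations make a Cauchy sequence locally uniformly Cauchy. Its holomorphic
pointwise limit is the limit in the seminorm by Fatou's lemma.
\<close>

lemma bergman_space_complete:
  fixes M :: "(complex^'n) measure"
  assumes dom: "locally_dominates_volume M \<Omega>" and p: "1 \<le> p"
    and f: "\<And>k. f k \<in> bergman_space \<Omega> p M" and cauchy: "Lp_Cauchy p M f"
  obtains F where "F \<in> bergman_space \<Omega> p M" "\<And>z. z \<in> \<Omega> \<Longrightarrow> (\<lambda>k. f k z) \<longlonglongrightarrow> F z"
    "(\<lambda>k. Lp_power p M (\<lambda>x. f k x - F x)) \<longlonglongrightarrow> 0"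
proof -
  have sets: "sets M = sets (restrict_space borel \<Omega>)"
    using dom by (simp add: locally_dominates_volume_def)
  then have space: "space M = \<Omega>"
    using sets_eq_imp_space_eq[OF sets] by (simp add: space_restrict_space)
  have hol: "holomorphic_fun_on (f k) \<Omega>" and Lp: "f k \<in> Lp_space p M" for k
    using f[of k] by (auto simp: bergman_space_def)
  have "\<exists>s>0. ball z0 s \<subseteq> \<Omega> \<and>
      (\<forall>e>0. \<exists>N. \<forall>i\<ge>N. \<forall>j\<ge>N. \<forall>z\<in>ball z0 s. cmod (f i z - f j z) \<le> e)" if z0: "z0 \<in> \<Omega>" for z0
  proof -
    obtain r D where r: "r > 0" "ball z0 r \<subseteq> \<Omega>" and D: "D \<ge> 0"
      "\<And>f z t J. holomorphic_fun_on f \<Omega> \<Longrightarrow> z \<in> ball z0 r \<Longrightarrow> t > 0 \<Longrightarrow> 0 \<le> J \<Longrightarrow>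
       Lp_power p M f \<le> ennreal J \<Longrightarrow> cmod (f z) \<le> t + D * t powr (1 - p) * J"
      using local_point_evaluation_bound[OF dom z0 p] by metis
    have "\<exists>N. \<forall>i\<ge>N. \<forall>j\<ge>N. \<forall>z\<in>ball z0 r. cmod (f i z - f j z) \<le> e" if e: "e > 0" for e
    proof -
      define t where "t = e / 2"
      define E where "E = D * t powr (1 - p) + 1"
      have t: "t > 0" using e by (simp add: t_def)
      have E: "E > 0" using D t by (auto simp: E_def intro!: add_nonneg_pos)
      obtain N where N: "\<And>i j. i \<ge> N \<Longrightarrow> j \<ge> N \<Longrightarrow> Lp_power p M (\<lambda>x. f i x - f j x) \<le> ennreal (t / E)"
        using cauchy t E unfolding Lp_Cauchy_def by (meson divide_pos_pos)
      have "cmod (f i z - f j z) \<le> e" if "i \<ge> N" "j \<ge> N" "z \<in> ball z0 r" for i j z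
      proof -
        have "cmod (f i z - f j z) \<le> t + D * t powr (1 - p) * (t / E)"
          using t E by (intro D(2)[OF holomorphic_fun_on_diff[OF hol hol]] that N) auto
        also have "\<dots> \<le> t + E * (t / E)"
          using t E by (intro add_left_mono mult_right_mono) (auto simp: E_def)
        also have "\<dots> = e" using E by (simp add: t_def)
        finally show ?thesis .
      qed
      then show ?thesis by blast
    qed
    then show ?thesis using r by blast
  qed
  from holomorphic_locally_uniform_limit[OF hol this]
  obtain F where F: "holomorphic_fun_on F \<Omega>" and lim: "\<And>z. z \<in> \<Omega> \<Longrightarrow> (\<lambda>k. f k z) \<longlonglongrightarrow> F z"
    by blast
  have AE: "AE x in M. (\<lambda>k. f (id k) x) \<longlonglongrightarrow> F x"
    using lim by (intro AE_I2) (simp add: space)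
  from p have p0: "0 < p" by simp
  note * = Lp_Cauchy_AE_limit[OF p0 Lp holomorphic_fun_on_borel_measurable[OF F sets] cauchy _ AE]
  show ?thesis
  proof (rule that[OF _ lim])
    show "F \<in> bergman_space \<Omega> p M" using *(1) F by (simp add: bergman_space_def strict_mono_def)
    show "(\<lambda>k. Lp_power p M (\<lambda>x. f k x - F x)) \<longlonglongrightarrow> 0" using *(2) by (simp add: strict_mono_def)
  qed
qed

section \<open>Hilbert space methods in \<open>A\<^sup>2\<close>\<close>

lemma cmod_powr_2: "cmod x powr 2 = (cmod x)\<^sup>2"
  by (cases "x = 0") (auto simp: powr_numeral)

definition L2_inner :: "'a measure \<Rightarrow> ('a \<Rightarrow> complex) \<Rightarrow> ('a \<Rightarrow> complex) \<Rightarrow> complex" where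
  "L2_inner M f g = (\<integral>x. f x * cnj (g x) \<partial>M)"

definition L2_energy :: "'a measure \<Rightarrow> ('a \<Rightarrow> complex) \<Rightarrow> real" where
  "L2_energy M f = (\<integral>x. (cmod (f x))\<^sup>2 \<partial>M)"

lemma L2_energy_nonneg: "0 \<le> L2_energy M f"
  by (simp add: L2_energy_def)

lemma L2_energy_integrable:
  assumes "f \<in> Lp_space 2 M"
  shows "integrable M (\<lambda>x. (cmod (f x))\<^sup>2)"
  using assms by (simp add: Lp_space_def cmod_powr_2)

lemma Lp_power_2_eq: "f \<in> Lp_space 2 M \<Longrightarrow> Lp_power 2 M f = ennreal (L2_energy M f)"
  using L2_energy_integrable[of f M]
  by (simp add: Lp_power_def L2_energy_def cmod_powr_2 nn_integral_eq_integral)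

lemma L2_inner_integrable:
  assumes f: "f \<in> Lp_space 2 M" and g: "g \<in> Lp_space 2 M"
  shows "integrable M (\<lambda>x. f x * cnj (g x))"
proof (rule Bochner_Integration.integrable_bound)
  show "integrable M (\<lambda>x. (cmod (f x))\<^sup>2 + (cmod (g x))\<^sup>2)"
    by (intro Bochner_Integration.integrable_add L2_energy_integrable f g)
  have [measurable]: "f \<in> borel_measurable M" "g \<in> borel_measurable M"
    using f g by (auto simp: Lp_space_iff)
  show "(\<lambda>x. f x * cnj (g x)) \<in> borel_measurable M"
    by (intro borel_measurable_times measurable_compose[OF _ borel_measurable_continuous_onI[of cnj]] continuous_intros) auto
  show "AE x in M. norm (f x * cnj (g x)) \<le> norm ((cmod (f x))\<^sup>2 + (cmod (g x))\<^sup>2)"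
  proof (rule AE_I2)
    fix x
    have "0 \<le> (cmod (f x) - cmod (g x))\<^sup>2 + (cmod (f x) - cmod (g x))\<^sup>2 + 2 * cmod (f x) * cmod (g x)"
      by simp
    then show "norm (f x * cnj (g x)) \<le> norm ((cmod (f x))\<^sup>2 + (cmod (g x))\<^sup>2)"
      by (simp add: norm_mult power2_eq_square algebra_simps)
  qed
qed

lemma L2_inner_commute: "L2_inner M g f = cnj (L2_inner M f g)"
  using Bochner_Integration.integral_cnj[of M "\<lambda>x. f x * cnj (g x)"]
  by (simp add: L2_inner_def mult.commute del: Bochner_Integration.integral_cnj)

lemma L2_inner_add_mult_left:
  assumes f: "f \<in> Lp_space 2 M" and g: "g \<in> Lp_space 2 M" and h: "h \<in> Lp_space 2 M"
  shows "L2_inner M (\<lambda>x. f x + c * g x) h = L2_inner M f h + c * L2_inner M g h"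
proof -
  have "(f x + c * g x) * cnj (h x) = f x * cnj (h x) + c * (g x * cnj (h x))" for x
    by (simp add: algebra_simps)
  then show ?thesis
    using L2_inner_integrable[OF f h] L2_inner_integrable[OF g h] by (simp add: L2_inner_def)
qed

lemma L2_inner_self: "L2_inner M f f = of_real (L2_energy M f)"
  unfolding L2_inner_def L2_energy_def
  by (simp add: complex_norm_square[symmetric] flip: integral_complex_of_real)

lemma L2_energy_expand:
  assumes f: "f \<in> Lp_space 2 M" and g: "g \<in> Lp_space 2 M"
  shows "L2_energy M (\<lambda>x. f x + c * g x) =
    L2_energy M f + 2 * Re (cnj c * L2_inner M f g) + (cmod c)\<^sup>2 * L2_energy M g"
proof -
  have pt: "(cmod (f x + c * g x))\<^sup>2 =
      (cmod (f x))\<^sup>2 + 2 * Re (cnj c * (f x * cnj (g x))) + (cmod c)\<^sup>2 * (cmod (g x))\<^sup>2" for x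
    unfolding cmod_power2 by (simp add: power2_eq_square algebra_simps)
  have int: "integrable M (\<lambda>x. cnj c * (f x * cnj (g x)))"
    by (intro integrable_mult_right L2_inner_integrable f g)
  have int2: "integrable M (\<lambda>x. 2 * Re (cnj c * (f x * cnj (g x))))"
    by (rule integrable_mult_right, rule integrable_Re, rule int)
  have "L2_energy M (\<lambda>x. f x + c * g x) =
      (\<integral>x. (cmod (f x))\<^sup>2 + 2 * Re (cnj c * (f x * cnj (g x))) + (cmod c)\<^sup>2 * (cmod (g x))\<^sup>2 \<partial>M)"
    by (simp only: L2_energy_def pt)
  also have "\<dots> = (\<integral>x. (cmod (f x))\<^sup>2 + 2 * Re (cnj c * (f x * cnj (g x))) \<partial>M) + (\<integral>x. (cmod c)\<^sup>2 * (cmod (g x))\<^sup>2 \<partial>M)"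
    by (intro Bochner_Integration.integral_add Bochner_Integration.integrable_add
        L2_energy_integrable f g integrable_mult_right int2)
  also have "(\<integral>x. (cmod (f x))\<^sup>2 + 2 * Re (cnj c * (f x * cnj (g x))) \<partial>M) =
      (\<integral>x. (cmod (f x))\<^sup>2 \<partial>M) + (\<integral>x. 2 * Re (cnj c * (f x * cnj (g x))) \<partial>M)"
    by (intro Bochner_Integration.integral_add L2_energy_integrable f int2)
  also have "(\<integral>x. 2 * Re (cnj c * (f x * cnj (g x))) \<partial>M) = 2 * Re (cnj c * L2_inner M f g)"
    unfolding L2_inner_def integral_mult_right_zero integral_Re[OF int] ..
  finally show ?thesis by (simp add: L2_energy_def)
qed

text \<open>
The discriminant argument, in a form that covers both the Cauchy--Schwarz inequality (\<open>A = \<parallel>f\<parallel>\<^sup>2\<close>) and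
the orthogonality of minimizers (\<open>A = 0\<close>), each with \<open>B = |\<langle>f,g\<rangle>|\<^sup>2\<close> and \<open>C = \<parallel>g\<parallel>\<^sup>2\<close>.
\<close>

lemma nonneg_quadratic_imp_le:
  fixes A B C :: real
  assumes nonneg: "\<And>s. 0 \<le> A - 2 * s * B + s\<^sup>2 * B * C" and "0 \<le> B" "0 \<le> C"
  shows "B \<le> A * C"
proof (cases "C = 0")
  case True
  have "B = 0"
  proof (rule ccontr)
    assume "B \<noteq> 0"
    then show False using nonneg[of "(A + 1) / (2 * B)"] True by simp
  qed
  then show ?thesis using True by simp
next
  case False
  then have C: "C > 0" using assms by simp
  have "0 \<le> A - B / C"
    using nonneg[of "1 / C"] C by (simp add: power2_eq_square field_simps)
  then show ?thesis using C by (simp add: field_simps)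
qed

lemma L2_energy_expand_along_inner:
  assumes f: "f \<in> Lp_space 2 M" and g: "g \<in> Lp_space 2 M"
  shows "L2_energy M (\<lambda>x. f x + (- of_real s * L2_inner M f g) * g x) =
    L2_energy M f - 2 * s * (cmod (L2_inner M f g))\<^sup>2 + s\<^sup>2 * (cmod (L2_inner M f g))\<^sup>2 * L2_energy M g"
proof -
  have "Re (cnj (- of_real s * a) * a) = - s * (cmod a)\<^sup>2" for a
    unfolding cmod_power2 by (simp add: power2_eq_square algebra_simps)
  then show ?thesis
    by (subst L2_energy_expand[OF f g]) (simp add: norm_mult power_mult_distrib)
qed

lemma L2_Cauchy_Schwarz:
  assumes f: "f \<in> Lp_space 2 M" and g: "g \<in> Lp_space 2 M"
  shows "(cmod (L2_inner M f g))\<^sup>2 \<le> L2_energy M f * L2_energy M g"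
proof (rule nonneg_quadratic_imp_le)
  show "0 \<le> L2_energy M f - 2 * s * (cmod (L2_inner M f g))\<^sup>2 + s\<^sup>2 * (cmod (L2_inner M f g))\<^sup>2 * L2_energy M g" for s
    using L2_energy_nonneg L2_energy_expand_along_inner[OF f g, of s] by metis
qed (auto simp: L2_energy_nonneg)

lemma bergman_space_subset_Lp: "f \<in> bergman_space \<Omega> p M \<Longrightarrow> f \<in> Lp_space p M"
  by (simp add: bergman_space_def)

lemma bergman_space_add_mult:
  assumes p: "0 < p" and f: "f \<in> bergman_space \<Omega> p M" and g: "g \<in> bergman_space \<Omega> p M"
  shows "(\<lambda>z. f z + c * g z) \<in> bergman_space \<Omega> p M"
proof -
  have Lp: "f \<in> Lp_space p M" "g \<in> Lp_space p M" using f g by (auto simp: bergman_space_def)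
  then have [measurable]: "g \<in> borel_measurable M" by (simp add: Lp_space_iff)
  have "Lp_power p M (\<lambda>z. - c * g z) = ennreal (cmod c powr p) * Lp_power p M g"
    unfolding Lp_power_def by (subst nn_integral_cmult[symmetric]) (auto simp: norm_mult powr_mult ennreal_mult)
  then have "(\<lambda>z. - c * g z) \<in> Lp_space p M"
    using Lp by (auto simp: Lp_space_iff ennreal_mult_less_top)
  from Lp_space_diff[OF _ Lp(1) this] p have "(\<lambda>z. f z + c * g z) \<in> Lp_space p M" by simp
  moreover have "holomorphic_fun_on (\<lambda>z. f z + c * g z) \<Omega>"
    using holomorphic_fun_on_linear[of f \<Omega> g 1 c] f g by (simp add: bergman_space_def)
  ultimately show ?thesis by (simp add: bergman_space_def)
qed

text \<open>
The Riesz representation of the point evaluation at \<open>w\<close>. Let \<open>F\<close> have minimal norm among the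
functions with value \<open>1\<close> at \<open>w\<close>; it exists because the parallelogram law makes minimizing sequences
Cauchy. By minimality \<open>F\<close> is orthogonal to all functions vanishing at \<open>w\<close>, so that
\<open>\<langle>f,F\<rangle> = f(w) \<parallel>F\<parallel>\<^sup>2\<close>, and \<open>F / \<parallel>F\<parallel>\<^sup>2\<close> represents the evaluation.
\<close>

lemma point_evaluation_representable:
  fixes M :: "(complex^'n) measure"
  assumes dom: "locally_dominates_volume M \<Omega>" and fin: "finite_measure M" and w: "w \<in> \<Omega>"
  obtains k where "k \<in> bergman_space \<Omega> 2 M"
    "\<And>f. f \<in> bergman_space \<Omega> 2 M \<Longrightarrow> f w = L2_inner M f k"
proof -
  interpret finite_measure M by (rule fin)
  let ?A = "bergman_space \<Omega> 2 M" and ?E = "L2_energy M"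
  have A_Lp: "f \<in> Lp_space 2 M" if "f \<in> ?A" for f using that by (rule bergman_space_subset_Lp)
  have A_add: "(\<lambda>z. f z + c * g z) \<in> ?A" if "f \<in> ?A" "g \<in> ?A" for f g c
    using that by (intro bergman_space_add_mult) auto
  define S where "S = {f \<in> ?A. f w = 1}"
  define d where "d = Inf (?E ` S)"
  have "(\<lambda>_. 1) \<in> S"
    by (auto simp: S_def bergman_space_def Lp_space_def holomorphic_fun_on_const)
  then have S_ne: "?E ` S \<noteq> {}" by blast
  have d_le: "d \<le> ?E f" if "f \<in> S" for f
    unfolding d_def using that
    by (intro cInf_lower bdd_belowI[of _ 0]) (auto simp: L2_energy_nonneg)
  have "\<exists>f\<in>S. ?E f < d + 1 / Suc n" for n
    using cInf_lessD[OF S_ne, of "d + 1 / Suc n"] by (force simp: d_def)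
  then obtain f where f: "\<And>n. f n \<in> S" "\<And>n. ?E (f n) < d + 1 / Suc n" by metis
  have fA: "f n \<in> ?A" and fw: "f n w = 1" for n using f(1)[of n] by (auto simp: S_def)
  have dist: "?E (\<lambda>x. f i x - f j x) \<le> 2 / Suc i + 2 / Suc j" for i j
  proof -
    \<comment> \<open>The midpoint of two competitors is a competitor, written with the available linear combinations.\<close>
    have "(\<lambda>x. (f i x + 1 * f j x) + (- 1 / 2) * (f i x + 1 * f j x)) \<in> S"
      using A_add[OF A_add[OF fA[of i] fA[of j], of 1] A_add[OF fA[of i] fA[of j], of 1], of "- 1 / 2"]
      by (simp add: S_def fw)
    then have "d \<le> ?E (\<lambda>x. (1 / 2) * (f i x + f j x))"
      using d_le by (force simp: field_simps)
    also have "\<dots> = ?E (\<lambda>x. f i x + 1 * f j x) / 4"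
      by (simp add: L2_energy_def norm_mult norm_divide power_mult_distrib power_divide)
    finally have "4 * d \<le> ?E (\<lambda>x. f i x + 1 * f j x)" by simp
    moreover have "?E (\<lambda>x. f i x + (- 1) * f j x) = 2 * ?E (f i) + 2 * ?E (f j) - ?E (\<lambda>x. f i x + 1 * f j x)"
      by (simp only: L2_energy_expand[OF A_Lp[OF fA] A_Lp[OF fA]]) simp
    ultimately show ?thesis using f(2)[of i] f(2)[of j] by simp
  qed
  have cauchy: "Lp_Cauchy 2 M f"
    unfolding Lp_Cauchy_def
  proof (intro allI impI)
    fix e :: real assume "e > 0"
    then obtain N where N: "1 / real (Suc N) < e / 4"
      using nat_approx_posE[of "e / 4"] by (metis zero_less_divide_iff zero_less_numeral)
    have "Lp_power 2 M (\<lambda>x. f i x - f j x) \<le> ennreal e" if "i \<ge> N" "j \<ge> N" for i j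
    proof -
      have "1 / real (Suc i) \<le> 1 / real (Suc N)" "1 / real (Suc j) \<le> 1 / real (Suc N)"
        using that by (auto simp: frac_le)
      then have "?E (\<lambda>x. f i x - f j x) \<le> e" using dist[of i j] N by simp
      moreover have "(\<lambda>x. f i x - f j x) \<in> Lp_space 2 M"
        by (intro Lp_space_diff A_Lp fA) simp
      ultimately show ?thesis by (simp add: Lp_power_2_eq ennreal_leI)
    qed
    then show "\<exists>N. \<forall>i\<ge>N. \<forall>j\<ge>N. Lp_power 2 M (\<lambda>x. f i x - f j x) \<le> ennreal e" by blast
  qed
  have le2: "(1::real) \<le> 2" by simp
  from bergman_space_complete[OF dom le2 fA cauchy]
  obtain F where F: "F \<in> ?A" and lim: "\<And>z. z \<in> \<Omega> \<Longrightarrow> (\<lambda>k. f k z) \<longlonglongrightarrow> F z" by metis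
  have "F w = 1" using lim[OF w] by (simp add: fw LIMSEQ_const_iff)
  then have FS: "F \<in> S" using F by (simp add: S_def)
  have "?E F \<le> d + e" if e: "e > 0" for e
  proof -
    have sets: "sets M = sets (restrict_space borel \<Omega>)"
      using dom by (simp add: locally_dominates_volume_def)
    have space: "space M = \<Omega>"
      using sets_eq_imp_space_eq[OF sets] by (simp add: space_restrict_space)
    have "Lp_power 2 M F \<le> ennreal (d + e)"
    proof (rule Lp_power_lower_semicontinuous)
      show "f k \<in> borel_measurable M" for k using A_Lp[OF fA] by (simp add: Lp_space_iff)
      show "AE x in M. (\<lambda>k. f k x) \<longlonglongrightarrow> F x" using lim by (intro AE_I2) (simp add: space)
      obtain N where N: "1 / real (Suc N) < e" using nat_approx_posE[OF e] by blast
      show "\<forall>\<^sub>F k in sequentially. Lp_power 2 M (f k) \<le> ennreal (d + e)"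
        using eventually_ge_at_top[of N]
      proof eventually_elim
        case (elim k)
        then have "1 / real (Suc k) \<le> 1 / real (Suc N)" by (auto simp: frac_le)
        then show ?case using f(2)[of k] N by (simp add: Lp_power_2_eq A_Lp fA ennreal_leI)
      qed
    qed simp
    moreover have "0 \<le> d" unfolding d_def by (rule cInf_greatest[OF S_ne]) (auto simp: L2_energy_nonneg)
    ultimately show ?thesis using e by (simp add: Lp_power_2_eq A_Lp F del: ennreal_plus)
  qed
  then have F_min: "?E F \<le> ?E g" if "g \<in> S" for g
    using d_le[OF that] field_le_epsilon[of "?E F" d] by (meson order_trans)
  have orth: "L2_inner M F h = 0" if h: "h \<in> ?A" and hw: "h w = 0" for h
  proof -
    have "(cmod (L2_inner M F h))\<^sup>2 \<le> 0 * ?E h"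
    proof (rule nonneg_quadratic_imp_le)
      fix s
      have "(\<lambda>x. F x + (- of_real s * L2_inner M F h) * h x) \<in> S"
        using A_add[OF F h, of "- of_real s * L2_inner M F h"] hw \<open>F w = 1\<close> by (simp add: S_def)
      from F_min[OF this]
      show "0 \<le> 0 - 2 * s * (cmod (L2_inner M F h))\<^sup>2 + s\<^sup>2 * (cmod (L2_inner M F h))\<^sup>2 * ?E h"
        unfolding L2_energy_expand_along_inner[OF A_Lp[OF F] A_Lp[OF h]] by simp
    qed (auto simp: L2_energy_nonneg)
    then show ?thesis by simp
  qed
  have pos: "?E F > 0"
  proof (rule ccontr)
    assume "\<not> ?E F > 0"
    then have "?E F = 0" using L2_energy_nonneg[of M F] by simp
    then have "Lp_power 2 M F \<le> ennreal 0" by (simp add: Lp_power_2_eq A_Lp F)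
    moreover obtain r D where "r > 0" and
      bound: "\<And>f z t J. holomorphic_fun_on f \<Omega> \<Longrightarrow> z \<in> ball w r \<Longrightarrow> t > 0 \<Longrightarrow> 0 \<le> J \<Longrightarrow>
        Lp_power 2 M f \<le> ennreal J \<Longrightarrow> cmod (f z) \<le> t + D * t powr (1 - 2) * J"
      using local_point_evaluation_bound[OF dom w le2] by metis
    moreover have "holomorphic_fun_on F \<Omega>" using F by (simp add: bergman_space_def)
    ultimately have "cmod (F w) \<le> 1 / 2"
      using bound[of F w "1 / 2" 0] by simp
    then show False by (simp add: \<open>F w = 1\<close>)
  qed
  show ?thesis
  proof (rule that[of "\<lambda>x. F x / of_real (?E F)"])
    show "(\<lambda>x. F x / of_real (?E F)) \<in> ?A"
      using A_add[OF F F, of "inverse (of_real (?E F)) - 1"] by (simp add: field_simps)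
    fix f assume f: "f \<in> ?A"
    have h: "(\<lambda>x. f x + (- f w) * F x) \<in> ?A" by (rule A_add[OF f F])
    have "L2_inner M (\<lambda>x. f x + (- f w) * F x) F = 0"
      using orth[OF h] \<open>F w = 1\<close> L2_inner_commute[of M _ F] by simp
    moreover have "L2_inner M (\<lambda>x. f x + (- f w) * F x) F = L2_inner M f F + (- f w) * L2_inner M F F"
      by (rule L2_inner_add_mult_left[OF A_Lp[OF f] A_Lp[OF F] A_Lp[OF F]])
    ultimately have "L2_inner M f F = f w * of_real (?E F)" by (simp add: L2_inner_self)
    then show "f w = L2_inner M f (\<lambda>x. F x / of_real (?E F))"
      using pos by (simp add: L2_inner_def)
  qed
qed

section \<open>The Bergman kernel on the diagonal and the weighted volume\<close>

lemma
  shows space_normalized_volume: "space (normalized_volume \<Omega>) = \<Omega>"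
    and sets_normalized_volume: "sets (normalized_volume \<Omega>) = sets (restrict_space borel \<Omega>)"
  by (auto simp: normalized_volume_def space_restrict_space intro!: sets_restrict_space_cong)

lemma nn_integral_normalized_volume:
  assumes "open \<Omega>" and h: "h \<in> borel_measurable (normalized_volume \<Omega>)"
  shows "(\<integral>\<^sup>+z. h z \<partial>normalized_volume \<Omega>) = (\<integral>\<^sup>+z. h z * indicator \<Omega> z \<partial>lborel) / emeasure lborel \<Omega>"
proof -
  have [simp]: "\<Omega> \<in> sets borel" using assms(1) by simp
  have *: "h \<in> borel_measurable (restrict_space lborel \<Omega>)"
    using h by (simp add: normalized_volume_def)
  have "(\<integral>\<^sup>+z. h z \<partial>normalized_volume \<Omega>) =
      (\<integral>\<^sup>+z. h z * indicator \<Omega> z \<partial>restrict_space lborel \<Omega>) / emeasure (restrict_space lborel \<Omega>) \<Omega>"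
    unfolding normalized_volume_def
    by (rule nn_integral_uniform_measure[OF *]) (auto simp: sets_restrict_space)
  also have "(\<integral>\<^sup>+z. h z * indicator \<Omega> z \<partial>restrict_space lborel \<Omega>) = (\<integral>\<^sup>+z. h z * indicator \<Omega> z \<partial>lborel)"
    by (subst nn_integral_restrict_space) (auto intro!: nn_integral_cong simp: indicator_def)
  also have "emeasure (restrict_space lborel \<Omega>) \<Omega> = emeasure lborel \<Omega>"
    by (subst emeasure_restrict_space) auto
  finally show ?thesis .
qed

context
  fixes \<Omega> :: "(complex^'n) set"
  assumes op: "open \<Omega>" and bdd: "bounded \<Omega>" and ne: "\<Omega> \<noteq> {}"
begin

lemma emeasure_domain: "emeasure lborel \<Omega> \<noteq> 0" "emeasure lborel \<Omega> < \<infinity>"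
proof -
  obtain z r where z: "r > 0" "ball z r \<subseteq> \<Omega>" using op ne open_contains_ball by (metis all_not_in_conv)
  have "0 < emeasure lborel (ball z r)"
    using z less_imp_neq[OF unit_ball_vol_pos[of "real DIM(complex^'n)"]]
    by (auto simp: emeasure_ball zero_less_iff_neq_zero simp del: DIM_cart)
  also have "\<dots> \<le> emeasure lborel \<Omega>" using z op by (intro emeasure_mono) auto
  finally show "emeasure lborel \<Omega> \<noteq> 0" by simp
  show "emeasure lborel \<Omega> < \<infinity>" using bdd emeasure_bounded_finite by auto
qed

lemma emeasure_normalized_volume: "emeasure (normalized_volume \<Omega>) \<Omega> = 1"
proof -
  have [simp]: "\<Omega> \<in> sets borel" using op by simp
  show ?thesis
    unfolding normalized_volume_def using emeasure_domain
    by (intro emeasure_uniform_measure_1) (auto simp: emeasure_restrict_space)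
qed

lemma finite_measure_normalized_volume: "finite_measure (normalized_volume \<Omega>)"
  by (rule finite_measureI) (simp add: space_normalized_volume emeasure_normalized_volume)

lemma locally_dominates_normalized_volume: "locally_dominates_volume (normalized_volume \<Omega>) \<Omega>"
  unfolding locally_dominates_volume_def
proof (intro conjI ballI sets_normalized_volume)
  fix z assume "z \<in> \<Omega>"
  then obtain r where r: "r > 0" "ball z r \<subseteq> \<Omega>" using op open_contains_ball by metis
  have "(\<integral>\<^sup>+w. h w * indicator (ball z r) w \<partial>lborel) \<le>
      ennreal (enn2real (emeasure lborel \<Omega>)) * (\<integral>\<^sup>+w. h w \<partial>normalized_volume \<Omega>)"
    if h: "h \<in> borel_measurable (normalized_volume \<Omega>)" for h
  proof -
    have "(\<integral>\<^sup>+w. h w * indicator (ball z r) w \<partial>lborel) \<le> (\<integral>\<^sup>+w. h w * indicator \<Omega> w \<partial>lborel)"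
      using r by (intro nn_integral_mono mult_left_mono) (auto simp: indicator_def)
    also have "\<dots> = emeasure lborel \<Omega> * (\<integral>\<^sup>+w. h w \<partial>normalized_volume \<Omega>)"
      using emeasure_domain
      by (simp add: nn_integral_normalized_volume[OF op h] ennreal_times_divide mult.commute[of "emeasure _ _"] ennreal_mult_divide_eq)
    finally show ?thesis using emeasure_domain(2) by simp
  qed
  then show "\<exists>r>0. \<exists>C\<ge>0. ball z r \<subseteq> \<Omega> \<and> (\<forall>h\<in>borel_measurable (normalized_volume \<Omega>).
      (\<integral>\<^sup>+w. h w * indicator (ball z r) w \<partial>lborel) \<le> ennreal C * (\<integral>\<^sup>+w. h w \<partial>normalized_volume \<Omega>))"
    using r enn2real_nonneg by blast
qed

lemma is_bergman_kernel_bergman_kernel: "is_bergman_kernel \<Omega> (bergman_kernel \<Omega>)"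
proof -
  have "\<forall>w\<in>\<Omega>. \<exists>k. k \<in> bergman_space \<Omega> 2 (normalized_volume \<Omega>) \<and>
      (\<forall>f\<in>bergman_space \<Omega> 2 (normalized_volume \<Omega>). f w = L2_inner (normalized_volume \<Omega>) f k)"
    using point_evaluation_representable[OF locally_dominates_normalized_volume finite_measure_normalized_volume]
    by metis
  then obtain k where "\<forall>w\<in>\<Omega>. k w \<in> bergman_space \<Omega> 2 (normalized_volume \<Omega>) \<and>
      (\<forall>f\<in>bergman_space \<Omega> 2 (normalized_volume \<Omega>). f w = L2_inner (normalized_volume \<Omega>) f (k w))"
    by metis
  then have "is_bergman_kernel \<Omega> (\<lambda>z w. k w z)"
    by (simp add: is_bergman_kernel_def L2_inner_def)
  then show ?thesis unfolding bergman_kernel_def by (rule someI[of "is_bergman_kernel \<Omega>"])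
qed

private abbreviation "V \<equiv> normalized_volume \<Omega>"
private abbreviation "kdiag z \<equiv> Re (bergman_kernel \<Omega> z z)"
private abbreviation "kslice w \<equiv> (\<lambda>z. bergman_kernel \<Omega> z w)"

lemma kernel_slice_in_bergman_space: "w \<in> \<Omega> \<Longrightarrow> kslice w \<in> bergman_space \<Omega> 2 V"
  using is_bergman_kernel_bergman_kernel by (simp add: is_bergman_kernel_def)

lemma bergman_kernel_reproducing:
  "w \<in> \<Omega> \<Longrightarrow> f \<in> bergman_space \<Omega> 2 V \<Longrightarrow> f w = L2_inner V f (kslice w)"
  using is_bergman_kernel_bergman_kernel by (simp add: is_bergman_kernel_def L2_inner_def)

lemma kernel_diagonal_eq:
  assumes w: "w \<in> \<Omega>"
  shows "bergman_kernel \<Omega> w w = of_real (kdiag w)" and "L2_energy V (kslice w) = kdiag w"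
proof -
  have eq: "bergman_kernel \<Omega> w w = of_real (L2_energy V (kslice w))"
    using bergman_kernel_reproducing[OF w kernel_slice_in_bergman_space[OF w]]
    unfolding L2_inner_self .
  then show "L2_energy V (kslice w) = kdiag w"
    by simp
  with eq show "bergman_kernel \<Omega> w w = of_real (kdiag w)" by (simp only:)
qed

text \<open>
The extremal property of the diagonal: Cauchy--Schwarz for \<open>f(w) = \<langle>f, K(\<cdot>,w)\<rangle>\<close>. Testing it with
particular functions gives all that is needed about \<open>K(w,w)\<close>.
\<close>

lemma point_evaluation_le_kernel_diagonal:
  assumes w: "w \<in> \<Omega>" and f: "f \<in> bergman_space \<Omega> 2 V"
  shows "(cmod (f w))\<^sup>2 \<le> L2_energy V f * kdiag w"
  using L2_Cauchy_Schwarz[OF bergman_space_subset_Lp[OF f] bergman_space_subset_Lp[OF kernel_slice_in_bergman_space[OF w]]]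
  unfolding kernel_diagonal_eq(2)[OF w] bergman_kernel_reproducing[OF w f, symmetric] .

text \<open>
The constant \<open>1\<close> has norm \<open>1\<close>, as the total volume is normalized.
\<close>

lemma kernel_diagonal_ge_1:
  assumes w: "w \<in> \<Omega>"
  shows "1 \<le> kdiag w"
proof -
  interpret finite_measure V by (rule finite_measure_normalized_volume)
  have "(\<lambda>_. 1) \<in> bergman_space \<Omega> 2 V"
    by (auto simp: bergman_space_def Lp_space_def holomorphic_fun_on_const)
  from point_evaluation_le_kernel_diagonal[OF w this] show ?thesis
    by (simp add: L2_energy_def measure_def space_normalized_volume emeasure_normalized_volume)
qed

lemma cmod_kernel_diagonal:
  assumes w: "w \<in> \<Omega>"
  shows "cmod (bergman_kernel \<Omega> w w) = kdiag w"
proof -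
  have "cmod (bergman_kernel \<Omega> w w) = cmod (of_real (kdiag w))"
    by (rule arg_cong[OF kernel_diagonal_eq(1)[OF w]])
  also have "\<dots> = kdiag w"
    unfolding norm_of_real using kernel_diagonal_ge_1[OF w] by linarith
  finally show ?thesis .
qed

text \<open>
Apply the local bound on point evaluations to \<open>K(\<cdot>,z)\<close> at \<open>z\<close>: its value there is \<open>K(z,z)\<close> and so is
its squared norm, which leaves \<open>K(z,z) \<le> (1 + D) \<surd>K(z,z)\<close>.
\<close>

lemma kernel_diagonal_locally_bounded:
  assumes z0: "z0 \<in> \<Omega>"
  obtains r B where "r > 0" "ball z0 r \<subseteq> \<Omega>" "\<And>z. z \<in> ball z0 r \<Longrightarrow> kdiag z \<le> B"
proof -
  have le2: "(1::real) \<le> 2" by simp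
  obtain r D where r: "r > 0" "ball z0 r \<subseteq> \<Omega>" and D: "D \<ge> 0" and
    bound: "\<And>f z t J. holomorphic_fun_on f \<Omega> \<Longrightarrow> z \<in> ball z0 r \<Longrightarrow> t > 0 \<Longrightarrow> 0 \<le> J \<Longrightarrow>
      Lp_power 2 V f \<le> ennreal J \<Longrightarrow> cmod (f z) \<le> t + D * t powr (1 - 2) * J"
    using local_point_evaluation_bound[OF locally_dominates_normalized_volume z0 le2] by metis
  have "kdiag z \<le> (1 + D)\<^sup>2" if z: "z \<in> ball z0 r" for z
  proof -
    have z\<Omega>: "z \<in> \<Omega>" using z r by blast
    note k1 = kernel_diagonal_ge_1[OF z\<Omega>]
    define s where "s = sqrt (kdiag z)"
    have s: "s > 0" "kdiag z = s * s" using k1 by (auto simp: s_def)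
    have "cmod (kslice z z) \<le> s + D * s powr (1 - 2) * kdiag z"
    proof (rule bound[of "kslice z" z s "kdiag z"])
      show "holomorphic_fun_on (kslice z) \<Omega>"
        using kernel_slice_in_bergman_space[OF z\<Omega>] by (simp add: bergman_space_def)
      show "Lp_power 2 V (kslice z) \<le> ennreal (kdiag z)"
        using kernel_slice_in_bergman_space[OF z\<Omega>]
        by (simp add: Lp_power_2_eq bergman_space_subset_Lp kernel_diagonal_eq(2)[OF z\<Omega>])
    qed (use z s k1 in auto)
    moreover have "cmod (kslice z z) = kdiag z"
      by (rule cmod_kernel_diagonal[OF z\<Omega>])
    moreover have "s powr (1 - 2) = 1 / s" using s by (simp add: powr_minus_divide)
    ultimately have "s * s \<le> s + D * s" using s by simp
    then have "s * s \<le> s * (1 + D)" by (simp add: algebra_simps)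
    then have "s \<le> 1 + D" using s by simp
    then show ?thesis using s by (simp add: power2_eq_square mult_mono)
  qed
  then show ?thesis using that r by blast
qed

text \<open>
Lower semicontinuity of the diagonal, which gives its measurability: near \<open>z\<close> it is bounded below
by the continuous function \<open>w \<mapsto> |K(w,z)|\<^sup>2 / K(z,z)\<close>, with equality at \<open>z\<close>.
\<close>

lemma open_kernel_diagonal_superlevel: "open {z \<in> \<Omega>. a < kdiag z}"
proof (subst open_subopen, intro ballI)
  fix z assume "z \<in> {z \<in> \<Omega>. a < kdiag z}"
  then have z: "z \<in> \<Omega>" and a: "a < kdiag z" by auto
  note k1 = kernel_diagonal_ge_1[OF z]
  have cont: "continuous_on \<Omega> (\<lambda>w. (cmod (kslice z w))\<^sup>2 / kdiag z)"
    using kernel_slice_in_bergman_space[OF z] k1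
    by (intro continuous_intros holomorphic_fun_on_continuous_on) (auto simp: bergman_space_def)
  define T where "T = {w \<in> \<Omega>. a < (cmod (kslice z w))\<^sup>2 / kdiag z}"
  have "open T"
    using continuous_open_preimage[OF cont op open_greaterThan[of a]]
    by (simp add: T_def vimage_def Int_def)
  moreover have "z \<in> T"
    using z a k1 by (simp add: T_def cmod_kernel_diagonal power2_eq_square)
  moreover have "T \<subseteq> {z \<in> \<Omega>. a < kdiag z}"
  proof
    fix w assume w: "w \<in> T"
    then have "w \<in> \<Omega>" by (simp add: T_def)
    from point_evaluation_le_kernel_diagonal[OF this kernel_slice_in_bergman_space[OF z]]
    have "(cmod (kslice z w))\<^sup>2 / kdiag z \<le> kdiag w"
      using k1 by (simp add: kernel_diagonal_eq(2)[OF z] field_simps)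
    then show "w \<in> {z \<in> \<Omega>. a < kdiag z}" using w by (auto simp: T_def)
  qed
  ultimately show "\<exists>T. open T \<and> z \<in> T \<and> T \<subseteq> {z \<in> \<Omega>. a < kdiag z}" by blast
qed

lemma kernel_weight_measurable: "kernel_weight \<Omega> lam \<in> borel_measurable V"
proof -
  have "(\<lambda>z. kdiag z) \<in> borel_measurable V"
    unfolding borel_measurable_iff_greater
  proof
    fix a
    have "{z \<in> space V. a < kdiag z} = {z \<in> \<Omega>. a < kdiag z} \<inter> \<Omega>"
      by (auto simp: space_normalized_volume)
    then show "{z \<in> space V. a < kdiag z} \<in> sets V"
      using open_kernel_diagonal_superlevel[of a]
      unfolding sets_normalized_volume sets_restrict_space
      by (intro image_eqI[of _ _ "{z \<in> \<Omega>. a < kdiag z}"]) auto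
  qed
  then show ?thesis unfolding kernel_weight_def by measurable
qed

lemma weight_constant_nonzero: "weight_constant \<Omega> lam \<noteq> 0"
proof
  assume "weight_constant \<Omega> lam = 0"
  then have "AE z in V. ennreal (kernel_weight \<Omega> lam z) = 0"
    unfolding weight_constant_def
    by (subst (asm) nn_integral_0_iff_AE) (use kernel_weight_measurable in auto)
  then have "AE z in V. False"
    using AE_space
  proof eventually_elim
    case (elim z)
    then show False using kernel_diagonal_ge_1[of z]
      by (simp add: kernel_weight_def space_normalized_volume)
  qed
  then obtain N where "\<Omega> \<subseteq> N" "emeasure V N = 0" "N \<in> sets V"
    using AE_E[of "\<lambda>_. False" V] by (auto simp: space_normalized_volume)
  then show False
    using emeasure_mono[of \<Omega> N V] emeasure_normalized_volume by simp
qed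

text \<open>
On a small ball \<open>1 \<le> K(z,z) \<le> B\<close>, so that \<open>K(z,z)\<^sup>\<lambda>\<close> is at least \<open>1\<close> or \<open>B\<^sup>\<lambda>\<close> according to the sign
of \<open>\<lambda>\<close>. The normalizing constant is finite by hypothesis and nonzero by \<open>weight_constant_nonzero\<close>.
\<close>

lemma locally_dominates_weighted_volume:
  assumes fin: "weight_constant \<Omega> lam < \<infinity>"
  shows "locally_dominates_volume (weighted_volume \<Omega> lam) \<Omega>"
  unfolding locally_dominates_volume_def
proof (intro conjI ballI)
  let ?M = "weighted_volume \<Omega> lam"
  have sets_M: "sets ?M = sets V" by (simp add: weighted_volume_def)
  then show "sets ?M = sets (restrict_space borel \<Omega>)" by (simp add: sets_normalized_volume)
  note [measurable] = kernel_weight_measurable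
  define c where "c = enn2real (weight_constant \<Omega> lam)"
  have c: "weight_constant \<Omega> lam = ennreal c" "c > 0"
    using fin weight_constant_nonzero[of lam] unfolding c_def
    by (auto simp: enn2real_positive_iff zero_less_iff_neq_zero)
  fix z assume z: "z \<in> \<Omega>"
  obtain r1 B where r1: "r1 > 0" "ball z r1 \<subseteq> \<Omega>" and B: "\<And>w. w \<in> ball z r1 \<Longrightarrow> kdiag w \<le> B"
    using kernel_diagonal_locally_bounded[OF z] by metis
  obtain r2 C where r2: "r2 > 0" "ball z r2 \<subseteq> \<Omega>" and C: "C \<ge> 0"
    "\<And>h. h \<in> borel_measurable V \<Longrightarrow>
       (\<integral>\<^sup>+w. h w * indicator (ball z r2) w \<partial>lborel) \<le> ennreal C * (\<integral>\<^sup>+w. h w \<partial>V)"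
    using locally_dominates_normalized_volume z unfolding locally_dominates_volume_def by blast
  define r where "r = min r1 r2"
  have B1: "1 \<le> B" using B[of z] kernel_diagonal_ge_1[OF z] r1 by auto
  define b where "b = min 1 (B powr lam)"
  have b: "b > 0" using B1 by (simp add: b_def)
  have weight_ge: "b \<le> kernel_weight \<Omega> lam w" if w: "w \<in> ball z r" for w
  proof -
    have k: "1 \<le> kdiag w" "kdiag w \<le> B" using w r1 B kernel_diagonal_ge_1[of w] by (auto simp: r_def)
    show ?thesis
    proof (cases "lam \<ge> 0")
      case True
      then have "1 \<le> kdiag w powr lam" using k by (simp add: ge_one_powr_ge_zero)
      then show ?thesis by (simp add: b_def kernel_weight_def)
    next
      case False
      then have "B powr lam \<le> kdiag w powr lam" using k by (intro powr_mono2') auto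
      then show ?thesis by (simp add: b_def kernel_weight_def)
    qed
  qed
  have "(\<integral>\<^sup>+w. h w * indicator (ball z r) w \<partial>lborel) \<le> ennreal (C * (c / b)) * (\<integral>\<^sup>+w. h w \<partial>?M)"
    if h: "h \<in> borel_measurable ?M" for h
  proof -
    have hV [measurable]: "h \<in> borel_measurable V" using h by (simp add: measurable_cong_sets[OF sets_M refl])
    have [measurable]: "ball z r \<in> sets V"
      using r1 by (auto simp: sets_normalized_volume sets_restrict_space r_def intro!: image_eqI[of _ _ "ball z (min r1 r2)"])
    have "(\<integral>\<^sup>+w. h w * indicator (ball z r) w \<partial>lborel) =
        (\<integral>\<^sup>+w. (h w * indicator (ball z r) w) * indicator (ball z r2) w \<partial>lborel)"
      by (intro nn_integral_cong) (auto simp: indicator_def r_def)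
    also have "\<dots> \<le> ennreal C * (\<integral>\<^sup>+w. h w * indicator (ball z r) w \<partial>V)"
      by (intro C(2)) measurable
    also have "\<dots> \<le> ennreal C * (\<integral>\<^sup>+w. ennreal (c / b) * (ennreal (kernel_weight \<Omega> lam w) / weight_constant \<Omega> lam * h w) \<partial>V)"
    proof (intro mult_left_mono nn_integral_mono)
      fix w
      show "h w * indicator (ball z r) w \<le> ennreal (c / b) * (ennreal (kernel_weight \<Omega> lam w) / weight_constant \<Omega> lam * h w)"
      proof (cases "w \<in> ball z r")
        case True
        have "1 * h w \<le> ennreal (c / b * (kernel_weight \<Omega> lam w / c)) * h w"
          using weight_ge[OF True] b c by (intro mult_right_mono) (auto simp: field_simps simp flip: ennreal_1 intro!: ennreal_leI)
        also have "\<dots> = ennreal (c / b) * (ennreal (kernel_weight \<Omega> lam w) / weight_constant \<Omega> lam * h w)"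
          using b c weight_ge[OF True] by (subst ennreal_mult) (auto simp: divide_ennreal mult.assoc)
        finally show ?thesis using True by simp
      qed simp
    qed simp
    also have "\<dots> = ennreal C * (ennreal (c / b) * (\<integral>\<^sup>+w. h w \<partial>?M))"
      by (simp add: nn_integral_cmult weighted_volume_def nn_integral_density)
    also have "\<dots> = ennreal (C * (c / b)) * (\<integral>\<^sup>+w. h w \<partial>?M)"
      using C c b by (subst ennreal_mult) (auto simp: mult.assoc)
    finally show ?thesis .
  qed
  moreover have "r > 0" "ball z r \<subseteq> \<Omega>" "C * (c / b) \<ge> 0" using r1 r2 C c b by (auto simp: r_def)
  ultimately show "\<exists>r>0. \<exists>C\<ge>0. ball z r \<subseteq> \<Omega> \<and> (\<forall>h\<in>borel_measurable ?M.
      (\<integral>\<^sup>+w. h w * indicator (ball z r) w \<partial>lborel) \<le> ennreal C * (\<integral>\<^sup>+w. h w \<partial>?M))"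
    by blast
qed

end

section \<open>Compactness and vanishing Carleson measures\<close>

text \<open>
With a complete target, the limit in the definition of compactness can be replaced by the Cauchy
condition, which refers to the seminorms of differences of images only.
\<close>

lemma compact_linear_map_iff_Cauchy_subsequence:
  assumes p: "0 < p" and Y: "Y \<subseteq> Lp_space p M"
    and complete: "\<And>u. (\<And>k. u k \<in> Y) \<Longrightarrow> Lp_Cauchy p M u \<Longrightarrow>
      \<exists>g\<in>Y. (\<lambda>k. Lp_power p M (\<lambda>x. u k x - g x)) \<longlonglongrightarrow> 0"
  shows "compact_linear_map X N Y (Lp_norm p M) T \<longleftrightarrow>
    (\<forall>f\<in>X. \<forall>g\<in>X. \<forall>a b. T (\<lambda>x. a * f x + b * g x) = (\<lambda>y. a * T f y + b * T g y)) \<and>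
    T ` X \<subseteq> Y \<and>
    (\<forall>f B. (\<forall>k. f k \<in> X \<and> N (f k) \<le> B) \<longrightarrow>
      (\<exists>r::nat \<Rightarrow> nat. strict_mono r \<and> Lp_Cauchy p M (\<lambda>k. T (f (r k)))))"
proof -
  have "(\<exists>g\<in>Y. (\<lambda>k. Lp_norm p M (\<lambda>y. u k y - g y)) \<longlonglongrightarrow> 0) \<longleftrightarrow> Lp_Cauchy p M u"
    if u: "\<And>k. u k \<in> Y" for u
  proof -
    have Lp: "u k \<in> Lp_space p M" "g \<in> Lp_space p M" if "g \<in> Y" for k g using u that Y by auto
    have meas: "u k \<in> borel_measurable M" "g \<in> borel_measurable M" if "g \<in> Y" for k g
      using Lp[OF that] by (auto simp: Lp_space_iff)
    have "(\<lambda>k. Lp_norm p M (\<lambda>y. u k y - g y)) \<longlonglongrightarrow> 0 \<longleftrightarrow> (\<lambda>k. Lp_power p M (\<lambda>y. u k y - g y)) \<longlonglongrightarrow> 0"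
      if "g \<in> Y" for g
      using p Lp[OF that] by (intro Lp_norm_tendsto_0_iff Lp_space_diff) auto
    moreover have "Lp_Cauchy p M u"
      if "g \<in> Y" "(\<lambda>k. Lp_power p M (\<lambda>y. u k y - g y)) \<longlonglongrightarrow> 0" for g
      using Lp_convergent_imp_Cauchy[OF _ meas[OF that(1)] that(2)] p by simp
    ultimately show ?thesis using complete[of u] u by blast
  qed
  note conv_iff = this
  show ?thesis
  proof (cases "T ` X \<subseteq> Y")
    case True
    have "(\<exists>g\<in>Y. \<exists>r::nat \<Rightarrow> nat. strict_mono r \<and> (\<lambda>k. Lp_norm p M (\<lambda>y. T (f (r k)) y - g y)) \<longlonglongrightarrow> 0) \<longleftrightarrow>
        (\<exists>r::nat \<Rightarrow> nat. strict_mono r \<and> Lp_Cauchy p M (\<lambda>k. T (f (r k))))"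
      if "\<forall>k. f k \<in> X" for f
    proof -
      have "(\<exists>g\<in>Y. (\<lambda>k. Lp_norm p M (\<lambda>y. T (f (r k)) y - g y)) \<longlonglongrightarrow> 0) \<longleftrightarrow>
          Lp_Cauchy p M (\<lambda>k. T (f (r k)))" for r :: "nat \<Rightarrow> nat"
        using that True by (intro conv_iff) blast
      then show ?thesis by blast
    qed
    then show ?thesis unfolding compact_linear_map_def by (simp add: True)
  next
    case False
    then show ?thesis unfolding compact_linear_map_def by simp
  qed
qed

text \<open>
The isometry behind the theorem, by the change of variables formula for image measures.
\<close>

lemma Lp_power_weighted_composition:
  assumes \<phi>: "\<phi> \<in> measurable M N" and \<psi>: "\<psi> \<in> borel_measurable M" and f: "f \<in> borel_measurable N"
  shows "Lp_power p (distr (density M (\<lambda>z. ennreal (cmod (\<psi> z) powr p))) N \<phi>) f =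
    Lp_power p M (weighted_composition \<phi> \<psi> f)"
proof -
  note [measurable] = \<phi> \<psi> f
  show ?thesis
    unfolding Lp_power_def weighted_composition_def
    by (simp add: nn_integral_distr nn_integral_density norm_mult powr_mult ennreal_mult)
qed

theorem theorem3p5:
  fixes \<Omega> :: "(complex^'n) set"
    and p lam \<epsilon> :: real
    and \<phi> :: "complex^'n \<Rightarrow> complex^'n"
    and \<psi> :: "complex^'n \<Rightarrow> complex"
  assumes "standard_bounded_symmetric_domain \<Omega>"
    and "1 \<le> p"
    and "\<epsilon> > 0"
    and "\<And>l. l < \<epsilon> \<Longrightarrow> weight_constant \<Omega> l < \<infinity>"
    and "lam < \<epsilon>"
    and "holomorphic_map_on \<phi> \<Omega>"
    and "\<phi> ` \<Omega> \<subseteq> \<Omega>"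
    and "\<psi> \<in> weighted_bergman_space \<Omega> p lam"
  shows "compact_linear_map
           (weighted_bergman_space \<Omega> p lam) (Lp_norm p (weighted_volume \<Omega> lam))
           (weighted_bergman_space \<Omega> p lam) (Lp_norm p (weighted_volume \<Omega> lam))
           (weighted_composition \<phi> \<psi>)
         \<longleftrightarrow> vanishing_carleson_measure \<Omega> p lam (pullback_measure \<Omega> lam \<phi> \<psi> p)"
proof -
  define M where "M = weighted_volume \<Omega> lam"
  define \<mu> where "\<mu> = pullback_measure \<Omega> lam \<phi> \<psi> p"
  let ?X = "bergman_space \<Omega> p M" and ?W = "weighted_composition \<phi> \<psi>"
  have p: "0 < p" using assms(2) by simp
  have "open \<Omega>" "bounded \<Omega>" "\<Omega> \<noteq> {}"
    using assms(1) by (auto simp: standard_bounded_symmetric_domain_def bounded_symmetric_domain_def)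
  then have dom: "locally_dominates_volume M \<Omega>"
    unfolding M_def using assms(4)[OF assms(5)] by (rule locally_dominates_weighted_volume)
  then have sets_M: "sets M = sets (restrict_space borel \<Omega>)"
    by (simp add: locally_dominates_volume_def)
  have sets_\<mu>: "sets \<mu> = sets (restrict_space borel \<Omega>)"
    by (simp add: \<mu>_def pullback_measure_def)
  have \<psi>: "holomorphic_fun_on \<psi> \<Omega>" "\<psi> \<in> borel_measurable M" "Lp_power p M \<psi> < \<infinity>"
    using assms(8) by (auto simp: M_def bergman_space_def Lp_space_iff)
  have \<phi>: "\<phi> \<in> measurable M (restrict_space borel \<Omega>)"
  proof (rule measurable_restrict_space2)
    have "\<phi> \<in> borel_measurable (restrict_space borel \<Omega>)"
      by (intro borel_measurable_continuous_on_restrict holomorphic_map_on_continuous_on assms(6))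
    then show "\<phi> \<in> borel_measurable M"
      by (simp add: measurable_cong_sets[OF sets_M refl])
    show "\<phi> \<in> space M \<rightarrow> \<Omega>"
      using assms(7) sets_eq_imp_space_eq[OF sets_M] by (auto simp: space_restrict_space)
  qed
  have isometry: "Lp_power p \<mu> f = Lp_power p M (?W f)" if "f \<in> borel_measurable (restrict_space borel \<Omega>)" for f
    unfolding \<mu>_def pullback_measure_def M_def[symmetric]
    by (rule Lp_power_weighted_composition[OF \<phi> \<psi>(2) that])
  have hol: "holomorphic_fun_on f \<Omega>" and meas: "f \<in> borel_measurable (restrict_space borel \<Omega>)" if "f \<in> ?X" for f
    using that holomorphic_fun_on_borel_measurable[of f \<Omega> "restrict_space borel \<Omega>"]
    by (auto simp: bergman_space_def)
  have fin: "finite_measure \<mu>"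
  proof (rule finite_measureI)
    have "emeasure \<mu> (space \<mu>) = Lp_power p \<mu> (\<lambda>_. 1)" by (simp add: Lp_power_def)
    also have "\<dots> = Lp_power p M \<psi>" by (subst isometry) (simp_all add: weighted_composition_def)
    finally show "emeasure \<mu> (space \<mu>) \<noteq> \<infinity>" using \<psi>(3) by simp
  qed
  have W_in_iff: "?W f \<in> ?X \<longleftrightarrow> f \<in> Lp_space p \<mu>" if f: "f \<in> ?X" for f
  proof -
    have "holomorphic_fun_on (?W f) \<Omega>"
      unfolding weighted_composition_def
      by (intro holomorphic_fun_on_mult \<psi> holomorphic_fun_on_compose[OF hol[OF f] assms(6,7)])
    then show ?thesis
      using meas[OF f] isometry[OF meas[OF f]]
      by (simp add: bergman_space_iff[OF sets_M] Lp_space_iff measurable_cong_sets[OF sets_\<mu> refl])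
  qed
  have Cauchy_iff: "Lp_Cauchy p M (\<lambda>k. ?W (u k)) \<longleftrightarrow> Lp_Cauchy p \<mu> u" if u: "\<And>k. u k \<in> ?X" for u
  proof -
    have "Lp_power p M (\<lambda>x. ?W (u i) x - ?W (u j) x) = Lp_power p \<mu> (\<lambda>x. u i x - u j x)" for i j
    proof -
      have "(\<lambda>x. u i x - u j x) \<in> borel_measurable (restrict_space borel \<Omega>)"
        by (intro borel_measurable_diff meas u)
      from isometry[OF this] show ?thesis
        by (simp add: weighted_composition_def right_diff_distrib)
    qed
    then show ?thesis by (simp add: Lp_Cauchy_def)
  qed
  have "compact_linear_map ?X (Lp_norm p M) ?X (Lp_norm p M) ?W \<longleftrightarrow>
      ?W ` ?X \<subseteq> ?X \<and> (\<forall>f B. (\<forall>k. f k \<in> ?X \<and> Lp_norm p M (f k) \<le> B) \<longrightarrow>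
        (\<exists>r::nat \<Rightarrow> nat. strict_mono r \<and> Lp_Cauchy p M (\<lambda>k. ?W (f (r k)))))"
  proof (subst compact_linear_map_iff_Cauchy_subsequence[OF p])
    show "\<exists>g\<in>?X. (\<lambda>k. Lp_power p M (\<lambda>x. u k x - g x)) \<longlonglongrightarrow> 0"
      if "\<And>k. u k \<in> ?X" "Lp_Cauchy p M u" for u
      using bergman_space_complete[OF dom assms(2) that] by metis
  qed (auto simp: bergman_space_def weighted_composition_def algebra_simps)
  also have "\<dots> \<longleftrightarrow> ?X \<subseteq> Lp_space p \<mu> \<and> (\<forall>f B. (\<forall>k. f k \<in> ?X \<and> Lp_norm p M (f k) \<le> B) \<longrightarrow>
        (\<exists>r::nat \<Rightarrow> nat. strict_mono r \<and> Lp_Cauchy p \<mu> (\<lambda>k. f (r k))))"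
  proof (rule conj_cong)
    show "?W ` ?X \<subseteq> ?X \<longleftrightarrow> ?X \<subseteq> Lp_space p \<mu>" using W_in_iff by blast
    have "Lp_Cauchy p M (\<lambda>k. ?W (f (r k))) \<longleftrightarrow> Lp_Cauchy p \<mu> (\<lambda>k. f (r k))"
      if "\<forall>k. f k \<in> ?X \<and> Lp_norm p M (f k) \<le> B" for f B and r :: "nat \<Rightarrow> nat"
      using Cauchy_iff[of "\<lambda>k. f (r k)"] that by blast
    then show "(\<forall>f B. (\<forall>k. f k \<in> ?X \<and> Lp_norm p M (f k) \<le> B) \<longrightarrow>
        (\<exists>r::nat \<Rightarrow> nat. strict_mono r \<and> Lp_Cauchy p M (\<lambda>k. ?W (f (r k))))) \<longleftrightarrow>
      (\<forall>f B. (\<forall>k. f k \<in> ?X \<and> Lp_norm p M (f k) \<le> B) \<longrightarrow>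
        (\<exists>r::nat \<Rightarrow> nat. strict_mono r \<and> Lp_Cauchy p \<mu> (\<lambda>k. f (r k))))"
      by metis
  qed
  also have "\<dots> \<longleftrightarrow> compact_linear_map ?X (Lp_norm p M) (Lp_space p \<mu>) (Lp_norm p \<mu>) (\<lambda>f. f)"
  proof (subst compact_linear_map_iff_Cauchy_subsequence[OF p])
    show "\<exists>g\<in>Lp_space p \<mu>. (\<lambda>k. Lp_power p \<mu> (\<lambda>x. u k x - g x)) \<longlonglongrightarrow> 0"
      if "\<And>k. u k \<in> Lp_space p \<mu>" "Lp_Cauchy p \<mu> u" for u
      using Lp_complete[OF assms(2) fin that] by metis
  qed auto
  finally show ?thesis
    using sets_\<mu> fin by (simp add: vanishing_carleson_measure_def M_def \<mu>_def)
qed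

end
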